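(* Let $\epsilon>0$ and let $p\in(0,1)$ be such that $1/p$ is an integer. Suppose that $n=q^4+1$ where $q$ is a prime power and $p\,q^3(q^6+q^4+q^2+1)$ is an integer. Then, as $q\to\infty$, $$\frac{H_3(n,p,\epsilon)}{E(n,p)}\ge (1/p)^{\Theta(n^{1/4})}.$$
   Context: A 3-graph $G$ has a vertex set and an edge set consisting of 3-element subsets of the vertex set. An $n$-vertex 3-graph has density $p$ if it has exactly $p\binom{n}{3}$ edges. A Hamiltonian cycle of an $n$-vertex 3-graph $G$ is given by an ordering $v_1,\dots,v_n$ of its vertices such that for every $i$ the set $\{v_i,v_{i+1},v_{i+2}\}$ (indices modulo $n$) is an edge; the cycle is identified with this set of $n$ edges. $H(G)$ is the number of Hamiltonian cycles of $G$. For $\epsilon>0$, an $n$-vertex 3-graph $G$ is $(\epsilon,p)$-quasi random if its density is $p$ and for every $W\subset V(G)$ with $|W|=\lfloor n/2\rfloor$, the induced 3-graph $G[W]$ has density in $(p-\epsilon,p+\epsilon)$. $H_3(n,p,\epsilon)$ is the maximum of $H(G)$ over all $n$-vertex $(\epsilon,p)$-quasi random 3-graphs. $E(n,p)=p^n(n-1)!/2$. *)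

theory Defs
  imports Complex_Main "HOL-Number_Theory.Prime_Powers"
begin

definition is_3graph :: "nat \<Rightarrow> nat set set \<Rightarrow> bool" where
  "is_3graph n G \<longleftrightarrow> (\<forall>e\<in>G. e \<subseteq> {0..<n} \<and> card e = 3)"

definition has_density :: "nat \<Rightarrow> real \<Rightarrow> nat set set \<Rightarrow> bool" where
  "has_density n p G \<longleftrightarrow> real (card G) = p * real (n choose 3)"

definition induced :: "nat set set \<Rightarrow> nat set \<Rightarrow> nat set set" where
  "induced G W = {e \<in> G. e \<subseteq> W}"

definition quasi_random :: "real \<Rightarrow> real \<Rightarrow> nat \<Rightarrow> nat set set \<Rightarrow> bool" where
  "quasi_random \<epsilon> p n G \<longleftrightarrow> is_3graph n G \<and> has_density n p G \<and>
     (\<forall>W. W \<subseteq> {0..<n} \<and> card W = n div 2 \<longrightarrow>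
        p - \<epsilon> < real (card (induced G W)) / real (card W choose 3) \<and>
        real (card (induced G W)) / real (card W choose 3) < p + \<epsilon>)"

definition cycle_edges :: "nat list \<Rightarrow> nat set set" where
  "cycle_edges vs = (let n = length vs in
     {{vs ! i, vs ! ((i + 1) mod n), vs ! ((i + 2) mod n)} | i. i < n})"

definition ham_cycles :: "nat \<Rightarrow> nat set set \<Rightarrow> nat set set set" where
  "ham_cycles n G = {cycle_edges vs | vs. distinct vs \<and> set vs = {0..<n} \<and> cycle_edges vs \<subseteq> G}"

definition H :: "nat \<Rightarrow> nat set set \<Rightarrow> nat" where
  "H n G = card (ham_cycles n G)"

definition H3 :: "nat \<Rightarrow> real \<Rightarrow> real \<Rightarrow> nat" where
  "H3 n p \<epsilon> = Sup {H n G | G. quasi_random \<epsilon> p n G}"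

definition Eexp :: "nat \<Rightarrow> real \<Rightarrow> real" where
  "Eexp n p = p ^ n * fact (n - 1) / 2"

end

theory Submission
  imports Defs "HOL-Combinatorics.Multiset_Permutations" "HOL-Real_Asymp.Real_Asymp"
begin

text \<open>
  Cut the \<open>n choose 3 = N * s\<close> triples into \<open>N\<close> clusters of size \<open>s = (q + 1) choose 3\<close> and let \<open>G\<close> be
  the union of \<open>p * N\<close> clusters chosen uniformly at random; its density is exactly \<open>p\<close>. A Chernoff
  bound gives failure probability \<open>exp (- \<Omega> (q ^ 9))\<close> for quasi-randomness at a given \<open>W\<close>, which beats
  both the \<open>2 ^ n\<close> sets \<open>W\<close> and the factor \<open>p ^ n\<close>. A cycle that meets \<open>k\<close> clusters lies in \<open>G\<close> with
  probability about \<open>p ^ k\<close>, so by convexity the expected number of Hamiltonian cycles exceeds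
  \<open>E(n, p)\<close> by \<open>1 / p\<close> to the average number of pairs of consecutive edges in a common cluster.

  No Steiner system is needed for this: it is enough that many pairs of triples in a cluster share two
  vertices. If clusters are intervals in the colexicographic order of the triples, the average
  number of coincidences is at least \<open>s / 32\<close>, of order \<open>q ^ 3\<close>. This leaves room for polynomial
  losses, so each cycle may be counted up to \<open>n ^ 3\<close> times.
\<close>

section \<open>Choosing a random subset of fixed size\<close>

text \<open>For negative \<open>y\<close>, put \<open>x = - y\<close> and multiply the Taylor bound
  1 + x + x^2/2 \<le> exp x by 1 - x + x^2: the product of the two polynomials is 1 + x^2/2 + x^3/2
  + x^4/2, which is at least 1. The quadratic term plays the role of the variance in the exponential
  moment estimate.\<close>

lemma exp_le_quadratic:
  fixes y :: real
  assumes "\<bar>y\<bar> \<le> 1"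
  shows "exp y \<le> 1 + y + y\<^sup>2"
proof (cases "y \<ge> 0")
  case True
  then show ?thesis using assms exp_bound by auto
next
  case False
  define x where "x = - y"
  have x: "x \<ge> 0" using False by (simp add: x_def)
  have "1 - x + x\<^sup>2 = (x - 1/2)\<^sup>2 + 3/4"
    by (simp add: power2_eq_square algebra_simps)
  then have pos: "1 - x + x\<^sup>2 > 0"
    using zero_le_power2[of "x - 1/2"] by linarith
  have "1 \<le> 1 + x\<^sup>2 / 2 + x^3 / 2 + x^4 / 2" using x by simp
  also have "\<dots> = (1 - x + x\<^sup>2) * (1 + x + x\<^sup>2 / 2)"
    by (simp add: field_simps power2_eq_square power3_eq_cube power4_eq_xxxx)
  also have "\<dots> \<le> (1 - x + x\<^sup>2) * exp x"
    using exp_lower_Taylor_quadratic[OF x] pos by (intro mult_left_mono) auto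
  finally have "exp (- x) \<le> 1 - x + x\<^sup>2"
    by (simp add: exp_minus field_simps)
  then show ?thesis by (simp add: x_def)
qed

text \<open>The right side is the expected product of the \<open>x i\<close> over a random subset
  that takes each \<open>i\<close> independently with probability \<open>p\<close>. Expanding it
  over all subsets and keeping only those of size \<open>M\<close> drops nonnegative terms.\<close>

lemma sum_subsets_prod_le:
  fixes x :: "'a \<Rightarrow> real"
  assumes "finite I" "\<And>i. i \<in> I \<Longrightarrow> 0 \<le> x i" "0 \<le> p" "p \<le> 1"
  shows "(\<Sum>S | S \<subseteq> I \<and> card S = M. \<Prod>i\<in>S. x i) * (p ^ M * (1 - p) ^ (card I - M))
           \<le> (\<Prod>i\<in>I. 1 - p + p * x i)"
proof -
  have "(\<Sum>S | S \<subseteq> I \<and> card S = M. \<Prod>i\<in>S. x i) * (p ^ M * (1 - p) ^ (card I - M))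
      = (\<Sum>S | S \<subseteq> I \<and> card S = M. (\<Prod>i\<in>S. p * x i) * (\<Prod>i\<in>I - S. 1 - p))"
    unfolding sum_distrib_right
  proof (intro sum.cong refl)
    fix S assume "S \<in> {S. S \<subseteq> I \<and> card S = M}"
    then have S: "S \<subseteq> I" "card S = M" by auto
    then have "card (I - S) = card I - M"
      using card_Diff_subset finite_subset assms(1) by metis
    then show "(\<Prod>i\<in>S. x i) * (p ^ M * (1 - p) ^ (card I - M))
        = (\<Prod>i\<in>S. p * x i) * (\<Prod>i\<in>I - S. 1 - p)"
      using S by (simp add: prod.distrib)
  qed
  also have "\<dots> \<le> (\<Sum>S\<in>Pow I. (\<Prod>i\<in>S. p * x i) * (\<Prod>i\<in>I - S. 1 - p))"
  proof (rule sum_mono2)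
    show "0 \<le> (\<Prod>i\<in>S. p * x i) * (\<Prod>i\<in>I - S. 1 - p)"
      if "S \<in> Pow I - {S. S \<subseteq> I \<and> card S = M}" for S
      using that assms by (intro mult_nonneg_nonneg prod_nonneg) auto
  qed (use assms in auto)
  also have "\<dots> = (\<Prod>i\<in>I. 1 - p + p * x i)"
    by (subst prod_add[symmetric]) (use assms in \<open>auto simp: add.commute\<close>)
  finally show ?thesis .
qed

text \<open>The terms of the binomial distribution rise up to \<open>k = M\<close> and fall
  afterwards, so the term at \<open>M\<close> is at least the average of the \<open>N + 1\<close>
  terms, which sum to 1.\<close>

lemma binomial_mode:
  fixes p :: real
  assumes p: "0 < p" "p < 1" and M: "real M = p * real N"
  shows "1 \<le> real (N + 1) * (real (N choose M) * (p ^ M * (1 - p) ^ (N - M)))"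
proof -
  define t where "t k = real (N choose k) * (p ^ k * (1 - p) ^ (N - k))" for k
  have t0: "t k \<ge> 0" for k using p by (simp add: t_def)
  \<comment> \<open>The ratio of consecutive terms in cross-multiplied form; it is at least 1
    exactly when \<open>k + 1 \<le> p * (N + 1)\<close>.\<close>
  have step: "t (Suc k) * (real (Suc k) * (1 - p)) = t k * (real (N - k) * p)" if "k < N" for k
  proof -
    have "(N choose Suc k) * Suc k = (N choose k) * (N - k)"
      using binomial_absorb_comp[of N k] binomial_absorption[of k N] by (simp add: mult.commute)
    then have "real (N choose Suc k) * real (Suc k) = real (N choose k) * real (N - k)"
      by (metis of_nat_mult)
    moreover have "N - k = Suc (N - Suc k)" using that by simp
    then have "(1 - p) ^ (N - k) = (1 - p) * (1 - p) ^ (N - Suc k)" by (metis power_Suc)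
    ultimately show ?thesis by (simp add: t_def)
  qed
  have up: "t k \<le> t (Suc k)" if "Suc k \<le> M" "k < N" for k
  proof -
    have "real (Suc k) \<le> p * real N" using that M by linarith
    then have "real (Suc k) * (1 - p) \<le> real (N - k) * p"
      using p that by (simp add: algebra_simps)
    then have "t k * (real (Suc k) * (1 - p)) \<le> t (Suc k) * (real (Suc k) * (1 - p))"
      unfolding step[OF that(2)] using t0 by (intro mult_left_mono) auto
    then show ?thesis using p by (simp add: mult_le_cancel_right)
  qed
  have down: "t (Suc k) \<le> t k" if "M \<le> k" "k < N" for k
  proof -
    have "p * real N \<le> real k" using that M by linarith
    then have "real (N - k) * p \<le> real (Suc k) * (1 - p)"
      using p that by (simp add: algebra_simps)
    then have "t (Suc k) * (real (Suc k) * (1 - p)) \<le> t k * (real (Suc k) * (1 - p))"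
      unfolding step[OF that(2)] using t0 by (intro mult_left_mono) auto
    then show ?thesis using p by (simp add: mult_le_cancel_right)
  qed
  have MN: "M \<le> N"
    using M p by (metis mult_left_le_one_le of_nat_0_le_iff of_nat_le_iff less_imp_le)
  have le1: "t k \<le> t M" if "k \<le> M" for k
    using that
  proof (induction rule: inc_induct)
    case (step k)
    then have "t k \<le> t (Suc k)" using up MN by simp
    then show ?case using step.IH by linarith
  qed simp
  have le2: "k \<le> N \<Longrightarrow> t k \<le> t M" if "M \<le> k" for k
    using that
  proof (induction rule: dec_induct)
    case (step k)
    then have "t (Suc k) \<le> t k" using down by simp
    then show ?case using step by simp
  qed simp
  have "1 = (p + (1 - p)) ^ N" by simp
  also have "\<dots> = (\<Sum>k\<le>N. t k)" unfolding binomial_ring t_def by (simp add: mult.assoc)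
  also have "\<dots> \<le> (\<Sum>k\<le>N. t M)" by (intro sum_mono) (use le1 le2 nat_le_linear in auto)
  finally show ?thesis by (simp add: t_def)
qed

text \<open>The hypergeometric distribution is the product measure conditioned on its most likely size,
  which costs a factor of at most the number of possible sizes.\<close>

lemma sum_exp_subsets_le:
  fixes w :: "'a \<Rightarrow> real"
  assumes I: "finite I" and p: "0 < p" "p < 1" and M: "real M = p * real (card I)"
    and w: "\<And>i. i \<in> I \<Longrightarrow> \<bar>w i\<bar> \<le> 1"
  shows "(\<Sum>S | S \<subseteq> I \<and> card S = M. exp (\<Sum>i\<in>S. w i))
      \<le> real (card I + 1) * real (card I choose M) * exp (p * (\<Sum>i\<in>I. w i) + p * (\<Sum>i\<in>I. (w i)\<^sup>2))"
proof -
  define X where "X = (\<Sum>S | S \<subseteq> I \<and> card S = M. exp (\<Sum>i\<in>S. w i))"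
  define t where "t = p ^ M * (1 - p) ^ (card I - M)"
  have "X * t = (\<Sum>S | S \<subseteq> I \<and> card S = M. \<Prod>i\<in>S. exp (w i)) * t"
    unfolding X_def by (intro arg_cong2[where f = "(*)"] sum.cong refl exp_sum)
      (use I finite_subset in auto)
  also have "\<dots> \<le> (\<Prod>i\<in>I. 1 - p + p * exp (w i))"
    unfolding t_def by (rule sum_subsets_prod_le) (use I p in auto)
  also have "\<dots> \<le> (\<Prod>i\<in>I. exp (p * w i + p * (w i)\<^sup>2))"
  proof (intro prod_mono conjI)
    fix i assume "i \<in> I"
    have "p * exp (w i) \<le> p * (1 + w i + (w i)\<^sup>2)"
      using p exp_le_quadratic[OF w[OF \<open>i \<in> I\<close>]] by (intro mult_left_mono) auto
    then have "1 - p + p * exp (w i) \<le> 1 + (p * w i + p * (w i)\<^sup>2)" by (simp add: algebra_simps)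
    also have "\<dots> \<le> exp (p * w i + p * (w i)\<^sup>2)" by (rule exp_ge_add_one_self)
    finally show "1 - p + p * exp (w i) \<le> exp (p * w i + p * (w i)\<^sup>2)" .
    show "0 \<le> 1 - p + p * exp (w i)" using p by (simp add: add_nonneg_nonneg)
  qed
  also have "\<dots> = exp (p * (\<Sum>i\<in>I. w i) + p * (\<Sum>i\<in>I. (w i)\<^sup>2))" (is "_ = ?E")
    using I by (simp add: exp_sum[symmetric] sum.distrib sum_distrib_left)
  finally have 1: "X * t \<le> ?E" .
  \<comment> \<open>Conditioning on size \<open>M\<close> divides by the probability of that size,
    which is at least \<open>1 / (card I + 1)\<close>.\<close>
  have 2: "1 \<le> real (card I + 1) * (real (card I choose M) * t)"
    unfolding t_def using p M by (rule binomial_mode)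
  have "0 \<le> X" unfolding X_def by (intro sum_nonneg) auto
  then have "X * 1 \<le> X * (real (card I + 1) * (real (card I choose M) * t))"
    using 2 by (intro mult_left_mono)
  also have "\<dots> = real (card I + 1) * real (card I choose M) * (X * t)" by (simp add: mult_ac)
  also have "\<dots> \<le> real (card I + 1) * real (card I choose M) * ?E"
    using 1 by (intro mult_left_mono) auto
  finally show ?thesis by (simp add: X_def)
qed

text \<open>Exponential Markov inequality with tilt \<open>\<delta> / b\<close>;
  \<open>\<sigma>\<close> selects the tail. Since the \<open>w i\<close> lie between 0 and
  \<open>b\<close>, their squares sum to at most \<open>b * A\<close>, so the second-order cost is
  at most \<open>\<delta>\<^sup>2 * A / b\<close>. The choice of \<open>\<delta>\<close> keeps every
  exponent \<open>v i\<close> in [-1, 1] and makes this cost at most half of the gain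
  \<open>\<delta> * \<epsilon> * A / b\<close>.\<close>

lemma card_subsets_deviation_one_sided:
  fixes w :: "'a \<Rightarrow> real" and \<sigma> :: real
  assumes I: "finite I" and p: "0 < p" "p < 1" and M: "real M = p * real (card I)"
    and b: "0 < b" and w: "\<And>i. i \<in> I \<Longrightarrow> 0 \<le> w i" "\<And>i. i \<in> I \<Longrightarrow> w i \<le> b"
    and eps: "0 < \<epsilon>" and \<sigma>: "\<bar>\<sigma>\<bar> = 1"
    and A: "A = (\<Sum>i\<in>I. w i)" and \<delta>: "\<delta> = min 1 \<epsilon> / 2"
  shows "real (card {S. S \<subseteq> I \<and> card S = M \<and> \<sigma> * ((\<Sum>i\<in>S. w i) - p * A) \<ge> \<epsilon> * A})
      \<le> real (card I + 1) * real (card I choose M) * exp (- (\<delta> * \<epsilon> / 2 * A / b))"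
proof -
  define B where "B = {S. S \<subseteq> I \<and> card S = M \<and> \<sigma> * ((\<Sum>i\<in>S. w i) - p * A) \<ge> \<epsilon> * A}"
  define v where "v i = \<sigma> * \<delta> / b * w i" for i
  have \<sigma>2: "\<sigma>\<^sup>2 = 1" using \<sigma> by (metis power2_abs power_one)
  have d: "0 < \<delta>" "\<delta> \<le> 1" "\<delta> \<le> \<epsilon> / 2" using eps \<delta> by auto
  have A0: "A \<ge> 0" unfolding A using w by (intro sum_nonneg) auto
  have sumv: "(\<Sum>i\<in>S. v i) = \<sigma> * \<delta> / b * (\<Sum>i\<in>S. w i)" for S
    by (simp add: v_def sum_distrib_left)
  have vb: "\<bar>v i\<bar> \<le> 1" if "i \<in> I" for i
  proof -
    have "\<bar>v i\<bar> = \<delta> * (w i / b)" using \<sigma> d b w that by (simp add: v_def abs_mult)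
    also have "\<dots> \<le> 1 * 1" using d b w that by (intro mult_mono) auto
    finally show ?thesis by simp
  qed
  have v2: "(\<Sum>i\<in>I. (v i)\<^sup>2) \<le> \<delta>\<^sup>2 / b * A"
    unfolding A sum_distrib_left
  proof (rule sum_mono)
    fix i assume i: "i \<in> I"
    have "(v i)\<^sup>2 = \<delta>\<^sup>2 / b\<^sup>2 * (w i * w i)"
      using \<sigma>2 by (simp add: v_def power_mult_distrib power_divide power2_eq_square)
    also have "\<dots> \<le> \<delta>\<^sup>2 / b\<^sup>2 * (b * w i)"
      using w i by (intro mult_left_mono mult_right_mono) auto
    also have "\<dots> = \<delta>\<^sup>2 / b * w i" using b by (simp add: power2_eq_square)
    finally show "(v i)\<^sup>2 \<le> \<delta>\<^sup>2 / b * w i" .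
  qed
  have fin: "finite {S. S \<subseteq> I \<and> card S = M}" using I by auto
  \<comment> \<open>The tilted mean, which enters both the lower and the upper estimate and
    cancels.\<close>
  define \<theta> where "\<theta> = \<sigma> * \<delta> / b * (p * A)"
  have "real (card B) * exp (\<theta> + \<delta> * \<epsilon> * A / b) = (\<Sum>S\<in>B. exp (\<theta> + \<delta> * \<epsilon> * A / b))" by simp
  also have "\<dots> \<le> (\<Sum>S\<in>B. exp (\<Sum>i\<in>S. v i))"
  proof (intro sum_mono)
    fix S assume "S \<in> B"
    then have "\<delta> / b * (\<epsilon> * A) \<le> \<delta> / b * (\<sigma> * ((\<Sum>i\<in>S. w i) - p * A))"
      unfolding B_def using d b by (intro mult_left_mono) auto
    then show "exp (\<theta> + \<delta> * \<epsilon> * A / b) \<le> exp (\<Sum>i\<in>S. v i)"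
      unfolding sumv \<theta>_def by (simp add: algebra_simps)
  qed
  also have "\<dots> \<le> (\<Sum>S | S \<subseteq> I \<and> card S = M. exp (\<Sum>i\<in>S. v i))"
    by (rule sum_mono2) (use fin in \<open>auto simp: B_def\<close>)
  also have "\<dots> \<le> real (card I + 1) * real (card I choose M)
      * exp (p * (\<Sum>i\<in>I. v i) + p * (\<Sum>i\<in>I. (v i)\<^sup>2))"
    using I p M vb by (rule sum_exp_subsets_le)
  also have "\<dots> \<le> real (card I + 1) * real (card I choose M) * exp (\<theta> + \<delta>\<^sup>2 / b * A)"
  proof (intro mult_left_mono)
    have "p * (\<Sum>i\<in>I. (v i)\<^sup>2) \<le> 1 * (\<delta>\<^sup>2 / b * A)"
      using p v2 by (intro mult_mono) (auto intro: sum_nonneg)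
    moreover have "p * (\<Sum>i\<in>I. v i) = \<theta>" unfolding sumv \<theta>_def A by simp
    ultimately show "exp (p * (\<Sum>i\<in>I. v i) + p * (\<Sum>i\<in>I. (v i)\<^sup>2)) \<le> exp (\<theta> + \<delta>\<^sup>2 / b * A)"
      by simp
  qed auto
  finally have "real (card B) \<le> real (card I + 1) * real (card I choose M)
      * (exp (\<theta> + \<delta>\<^sup>2 / b * A) / exp (\<theta> + \<delta> * \<epsilon> * A / b))"
    by (simp add: field_simps)
  also have "exp (\<theta> + \<delta>\<^sup>2 / b * A) / exp (\<theta> + \<delta> * \<epsilon> * A / b) = exp (\<delta>\<^sup>2 / b * A - \<delta> * \<epsilon> * A / b)"
    by (simp add: exp_diff[symmetric])
  also have "real (card I + 1) * real (card I choose M) * \<dots>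
      \<le> real (card I + 1) * real (card I choose M) * exp (- (\<delta> * \<epsilon> / 2 * A / b))"
  proof (intro mult_left_mono)
    have "\<delta> * \<delta> * (A / b) \<le> \<delta> * (\<epsilon> / 2) * (A / b)"
      using d A0 b by (intro mult_right_mono mult_left_mono) auto
    then show "exp (\<delta>\<^sup>2 / b * A - \<delta> * \<epsilon> * A / b) \<le> exp (- (\<delta> * \<epsilon> / 2 * A / b))"
      by (simp add: power2_eq_square algebra_simps)
  qed auto
  finally show ?thesis unfolding B_def .
qed

lemma card_subsets_deviation:
  fixes w :: "'a \<Rightarrow> real"
  assumes I: "finite I" and p: "0 < p" "p < 1" and M: "real M = p * real (card I)"
    and b: "0 < b" and w: "\<And>i. i \<in> I \<Longrightarrow> 0 \<le> w i" "\<And>i. i \<in> I \<Longrightarrow> w i \<le> b"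
    and eps: "0 < \<epsilon>" and A: "A = (\<Sum>i\<in>I. w i)" and \<delta>: "\<delta> = min 1 \<epsilon> / 2"
  shows "real (card {S. S \<subseteq> I \<and> card S = M \<and> \<bar>(\<Sum>i\<in>S. w i) - p * A\<bar> \<ge> \<epsilon> * A})
      \<le> 2 * real (card I + 1) * real (card I choose M) * exp (- (\<delta> * \<epsilon> / 2 * A / b))"
proof -
  define B where "B \<sigma> = {S. S \<subseteq> I \<and> card S = M \<and> \<sigma> * ((\<Sum>i\<in>S. w i) - p * A) \<ge> \<epsilon> * A}" for \<sigma> :: real
  have "{S. S \<subseteq> I \<and> card S = M \<and> \<bar>(\<Sum>i\<in>S. w i) - p * A\<bar> \<ge> \<epsilon> * A} \<subseteq> B 1 \<union> B (-1)"
    by (auto simp: B_def)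
  moreover have "finite (B \<sigma>)" for \<sigma> using I by (auto simp: B_def)
  ultimately have "card {S. S \<subseteq> I \<and> card S = M \<and> \<bar>(\<Sum>i\<in>S. w i) - p * A\<bar> \<ge> \<epsilon> * A} \<le> card (B 1) + card (B (-1))"
    by (meson card_Un_le card_mono finite_UnI le_trans)
  moreover have "real (card (B \<sigma>)) \<le> real (card I + 1) * real (card I choose M) * exp (- (\<delta> * \<epsilon> / 2 * A / b))"
    if "\<bar>\<sigma>\<bar> = 1" for \<sigma>
    unfolding B_def using I p M b w eps that A \<delta> by (rule card_subsets_deviation_one_sided)
  from this[of 1] this[of "-1"] have "real (card (B 1)) + real (card (B (-1)))
      \<le> 2 * real (card I + 1) * real (card I choose M) * exp (- (\<delta> * \<epsilon> / 2 * A / b))"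
    by (simp add: algebra_simps)
  ultimately show ?thesis by linarith
qed

section \<open>Subsets that contain a prescribed set\<close>

lemma card_supersets:
  assumes "finite I" "K \<subseteq> I" "card K \<le> M"
  shows "card {S. S \<subseteq> I \<and> card S = M \<and> K \<subseteq> S} = (card I - card K choose (M - card K))"
proof -
  have finK: "finite K" using assms finite_subset by auto
  have "bij_betw (\<lambda>S. S - K) {S. S \<subseteq> I \<and> card S = M \<and> K \<subseteq> S} {S. S \<subseteq> I - K \<and> card S = M - card K}"
  proof (rule bij_betw_byWitness[where f' = "\<lambda>S. S \<union> K"])
    show "(\<lambda>S. S - K) ` {S. S \<subseteq> I \<and> card S = M \<and> K \<subseteq> S} \<subseteq> {S. S \<subseteq> I - K \<and> card S = M - card K}"
      using finK by (auto simp: card_Diff_subset)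
    show "(\<lambda>S. S \<union> K) ` {S. S \<subseteq> I - K \<and> card S = M - card K} \<subseteq> {S. S \<subseteq> I \<and> card S = M \<and> K \<subseteq> S}"
    proof (clarsimp, intro conjI)
      fix S assume S: "S \<subseteq> I - K" "card S = M - card K"
      have "card (S \<union> K) = card S + card K"
        using S finK assms by (intro card_Un_disjoint) (auto intro: finite_subset)
      then show "card (S \<union> K) = M" using S assms by simp
    qed (use assms in auto)
  qed auto
  then have "card {S. S \<subseteq> I \<and> card S = M \<and> K \<subseteq> S} = card {S. S \<subseteq> I - K \<and> card S = M - card K}"
    by (rule bij_betw_same_card)
  also have "\<dots> = (card (I - K) choose (M - card K))" using assms by (intro n_subsets) auto
  also have "card (I - K) = card I - card K" using assms finK by (simp add: card_Diff_subset)
  finally show ?thesis .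
qed

text \<open>A uniformly random \<open>M\<close>-set contains a fixed \<open>k\<close>-set with
  probability the product of (M - j) / (N - j) over j < k. Each factor is at least p * (1 - j / M),
  and the losses j / M add up to at most k^2 / M.\<close>

lemma binomial_diff_ge:
  fixes p :: real
  assumes p: "0 < p" "p < 1" and M: "real M = p * real N" and kM: "k \<le> M"
  shows "p ^ k * (1 - real (k\<^sup>2) / real M) * real (N choose M) \<le> real (N - k choose (M - k))"
  using kM
proof (induction k)
  case (Suc k)
  define r where "r = real (N - k choose (M - k))"
  have Mpos: "0 < real M" using Suc by simp
  have Npos: "0 < real N" using Mpos M p by (simp add: zero_less_mult_iff)
  have MN: "M \<le> N"
    using M p by (metis mult_left_le_one_le of_nat_0_le_iff of_nat_le_iff less_imp_le)
  have IH: "p ^ k * (1 - real (k\<^sup>2) / real M) * real (N choose M) \<le> r"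
    using Suc by (simp add: r_def)
  have "Suc (M - Suc k) * (Suc (N - Suc k) choose Suc (M - Suc k)) = Suc (N - Suc k) * (N - Suc k choose (M - Suc k))"
    by (rule Suc_times_binomial)
  moreover have "Suc (M - Suc k) = M - k" "Suc (N - Suc k) = N - k" using Suc.prems MN by auto
  ultimately have "(M - k) * (N - k choose (M - k)) = (N - k) * (N - Suc k choose (M - Suc k))" by simp
  then have eq: "real (M - k) * r = real (N - k) * real (N - Suc k choose (M - Suc k))"
    unfolding r_def by (metis of_nat_mult)
  have Nk: "0 < real (N - k)" using Suc.prems MN by simp
  have ratio: "p * (1 - real k / real M) \<le> real (M - k) / real (N - k)"
  proof -
    have "p * (1 - real k / real M) = real (M - k) / real N"
      using Suc.prems Mpos M Npos p by (simp add: field_simps of_nat_diff)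
    also have "\<dots> \<le> real (M - k) / real (N - k)"
      using Nk by (intro divide_left_mono) auto
    finally show ?thesis .
  qed
  have "p ^ Suc k * (1 - real ((Suc k)\<^sup>2) / real M) * real (N choose M)
      \<le> p ^ Suc k * ((1 - real (k\<^sup>2) / real M) * (1 - real k / real M)) * real (N choose M)"
  proof (intro mult_right_mono mult_left_mono)
    have sq: "real ((Suc k)\<^sup>2) / real M \<ge> real (k\<^sup>2) / real M + real k / real M"
      unfolding add_divide_distrib[symmetric] using Mpos
      by (intro divide_right_mono) (auto simp: power2_eq_square algebra_simps)
    have "1 - (x + y) \<le> (1 - x) * (1 - y)" if "0 \<le> x" "0 \<le> y" for x y :: real
      using that by (simp add: algebra_simps)
    from this[of "real (k\<^sup>2) / real M" "real k / real M"] sq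
    show "1 - real ((Suc k)\<^sup>2) / real M \<le> (1 - real (k\<^sup>2) / real M) * (1 - real k / real M)"
      by simp
  qed (use p in auto)
  also have "\<dots> = (p ^ k * (1 - real (k\<^sup>2) / real M) * real (N choose M)) * (p * (1 - real k / real M))"
    by (simp add: mult_ac)
  also have "\<dots> \<le> r * (p * (1 - real k / real M))"
    using IH p Suc.prems Mpos by (intro mult_right_mono mult_nonneg_nonneg) auto
  also have "\<dots> \<le> r * (real (M - k) / real (N - k))"
    using ratio by (intro mult_left_mono) (auto simp: r_def)
  also have "\<dots> = real (N - Suc k choose (M - Suc k))"
    using eq Nk by (simp add: field_simps)
  finally show ?case .
qed simp

section \<open>Clustering the triples\<close>

definition triples :: "nat \<Rightarrow> nat set set" where
  "triples n = {e. e \<subseteq> {0..<n} \<and> card e = 3}"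

lemma finite_triples [simp]: "finite (triples n)"
  by (rule finite_subset[of _ "Pow {0..<n}"]) (auto simp: triples_def)

lemma card_triples: "card (triples n) = n choose 3"
  unfolding triples_def using n_subsets[of "{0..<n}" 3] by simp

lemma triple_sorted:
  fixes e :: "nat set"
  assumes "card e = 3"
  obtains a b c where "a < b" "b < c" "e = {a, b, c}"
proof -
  obtain x y z where e: "e = {x, y, z}" "x \<noteq> y" "y \<noteq> z" "x \<noteq> z"
    using assms card_3_iff by metis
  consider "x < y" "y < z" | "x < z" "z < y" | "y < x" "x < z" | "y < z" "z < x"
    | "z < x" "x < y" | "z < y" "y < x" using e by linarith
  then show ?thesis
  proof cases
    case 1 then show ?thesis using that[of x y z] e by simp
  next
    case 2 then show ?thesis using that[of x z y] e by (simp add: insert_commute)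
  next
    case 3 then show ?thesis using that[of y x z] e by (simp add: insert_commute)
  next
    case 4 then show ?thesis using that[of y z x] e by (simp add: insert_commute)
  next
    case 5 then show ?thesis using that[of z x y] e by (simp add: insert_commute)
  next
    case 6 then show ?thesis using that[of z y x] e by (simp add: insert_commute)
  qed
qed

text \<open>The combinatorial number system: \<open>{a < b < c}\<close> is encoded as
  \<open>(c choose 3) + (b choose 2) + a\<close>.\<close>

definition triple_rank :: "nat set \<Rightarrow> nat" where
  "triple_rank e = (\<Sum>x\<in>e. x choose card {y \<in> e. y \<le> x})"

lemma triple_rank_sorted:
  assumes "a < b" "b < c"
  shows "triple_rank {a, b, c} = a + (b choose 2) + (c choose 3)"
proof -
  have "{y \<in> {a, b, c}. y \<le> a} = {a}" "{y \<in> {a, b, c}. y \<le> b} = {a, b}"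
    "{y \<in> {a, b, c}. y \<le> c} = {a, b, c}" using assms by auto
  then show ?thesis using assms unfolding triple_rank_def
    by (simp add: numeral_3_eq_3 numeral_2_eq_2)
qed

lemma binomial_Suc_2: "Suc b choose 2 = b + (b choose 2)"
  using binomial_Suc_Suc[of b 1] by (simp add: numeral_2_eq_2)

lemma binomial_Suc_3: "Suc b choose 3 = (b choose 2) + (b choose 3)"
  using binomial_Suc_Suc[of b 2] by (simp add: numeral_3_eq_3 numeral_2_eq_2)

lemma pair_rank_less:
  assumes "a < b" "b < (c::nat)"
  shows "a + (b choose 2) < c choose 2"
  using binomial_right_mono[of "Suc b" c 2] assms by (simp add: binomial_Suc_2)

lemma triple_rank_less:
  assumes "a < b" "b < c" "c < (n::nat)"
  shows "a + (b choose 2) + (c choose 3) < n choose 3"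
  using binomial_right_mono[of "Suc c" n 3] pair_rank_less[of a b c] assms by (simp add: binomial_Suc_3)

text \<open>The largest element can be read off from the rank: if c < c', then the first rank is
  below \<open>c' choose 3\<close>, hence below the second. Once the largest elements agree, the
  same argument applies to the remaining pairs.\<close>

lemma triple_rank_inject:
  assumes "a < b" "b < c" "a' < b'" "b' < (c'::nat)"
    and eq: "a + (b choose 2) + (c choose 3) = a' + (b' choose 2) + (c' choose 3)"
  shows "a = a' \<and> b = b' \<and> c = c'"
proof -
  have "c = c'"
    using triple_rank_less[of a b c c'] triple_rank_less[of a' b' c' c] assms
    by (metis less_asym less_irrefl linorder_neqE_nat trans_less_add2)
  moreover from this eq have "a + (b choose 2) = a' + (b' choose 2)" by simp
  then have "b = b'"
    using pair_rank_less[of a b b'] pair_rank_less[of a' b' b] assms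
    by (metis less_irrefl linorder_neqE_nat trans_less_add2)
  ultimately show ?thesis using eq by simp
qed

text \<open>Injectivity suffices, because both sides have \<open>n choose 3\<close>
  elements.\<close>

lemma bij_betw_triple_rank: "bij_betw triple_rank (triples n) {..<n choose 3}"
proof -
  have "inj_on triple_rank (triples n)"
  proof (rule inj_onI)
    fix e e' assume "e \<in> triples n" "e' \<in> triples n" and eq: "triple_rank e = triple_rank e'"
    then have "card e = 3" "card e' = 3" by (auto simp: triples_def)
    then obtain a b c a' b' c' where "a < b" "b < c" "e = {a, b, c}" "a' < b'" "b' < c'" "e' = {a', b', c'}"
      using triple_sorted by metis
    then show "e = e'" using eq triple_rank_inject[of a b c a' b' c'] by (simp add: triple_rank_sorted)
  qed
  moreover have "triple_rank ` triples n \<subseteq> {..<n choose 3}"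
  proof (rule image_subsetI)
    fix e assume e: "e \<in> triples n"
    then have "card e = 3" by (auto simp: triples_def)
    then obtain a b c where "a < b" "b < c" "e = {a, b, c}" using triple_sorted by metis
    then show "triple_rank e \<in> {..<n choose 3}"
      using e triple_rank_less[of a b c n] by (simp add: triple_rank_sorted triples_def)
  qed
  ultimately show ?thesis
    by (simp add: bij_betw_def card_image card_subset_eq card_triples)
qed

text \<open>Equal cluster sizes make the density of a union of clusters exact, and \<open>s\<close>
  bounds the influence of one cluster in the tail bound. The first-moment argument uses only these
  axioms; the particular clustering matters only for the number of coincidences.\<close>

locale triple_clustering =
  fixes n N s :: nat and f :: "nat set \<Rightarrow> nat"
  assumes s_pos: "0 < s"
    and cluster_less: "e \<in> triples n \<Longrightarrow> f e < N"
    and card_cluster: "i < N \<Longrightarrow> card {e \<in> triples n. f e = i} = s"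

text \<open>Division by \<open>s\<close> cuts the rank range, of length \<open>N * s\<close>, into
  \<open>N\<close> full intervals; no incomplete cluster remains.\<close>

lemma triple_clustering_rank:
  assumes "0 < s" "n choose 3 = N * s"
  shows "triple_clustering n N s (\<lambda>e. triple_rank e div s)"
proof
  show "triple_rank e div s < N" if "e \<in> triples n" for e
    using bij_betw_apply[OF bij_betw_triple_rank that] assms by (simp add: less_mult_imp_div_less)
  show "card {e \<in> triples n. triple_rank e div s = i} = s" if "i < N" for i
  proof -
    have "bij_betw triple_rank {e \<in> triples n. triple_rank e div s = i} {i * s..<i * s + s}"
    proof (rule bij_betw_subset[OF bij_betw_triple_rank])
      have "{i * s..<i * s + s} = {r \<in> {..<n choose 3}. r div s = i}"
      proof (intro set_eqI iffI)
        fix r assume r: "r \<in> {i * s..<i * s + s}"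
        have "Suc i * s \<le> N * s" using that by (intro mult_right_mono) auto
        then have "r < n choose 3" using r assms by auto
        moreover have "r div s = i" using r by (intro div_nat_eqI) (auto simp: mult.commute)
        ultimately show "r \<in> {r \<in> {..<n choose 3}. r div s = i}" by simp
      next
        fix r assume "r \<in> {r \<in> {..<n choose 3}. r div s = i}"
        then have "r div s = i" by simp
        then show "r \<in> {i * s..<i * s + s}"
          using assms(1) div_mult_mod_eq[of r s] mod_less_divisor[of s r] by (auto simp del: mod_less_divisor)
      qed
      also have "\<dots> = triple_rank ` {e \<in> triples n. triple_rank e div s = i}"
        using bij_betw_imp_surj_on[OF bij_betw_triple_rank[of n]] by auto
      finally show "triple_rank ` {e \<in> triples n. triple_rank e div s = i} = {i * s..<i * s + s}" ..
    qed auto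
    then show ?thesis using bij_betw_same_card by fastforce
  qed
qed (use assms in simp)

section \<open>Unions of clusters as quasi-random 3-graphs\<close>

context triple_clustering
begin

definition cluster_graph :: "nat set \<Rightarrow> nat set set" where
  "cluster_graph S = {e \<in> triples n. f e \<in> S}"

text \<open>The contribution of one cluster to the edges inside \<open>W\<close>. For random
  \<open>S\<close> the edge count in \<open>W\<close> is a sum of these weights, to which the tail
  bound applies with \<open>b = s\<close>.\<close>

definition weight :: "nat set \<Rightarrow> nat \<Rightarrow> nat" where
  "weight W i = card {e \<in> triples n. e \<subseteq> W \<and> f e = i}"

lemma weight_le: "i < N \<Longrightarrow> weight W i \<le> s"
  unfolding weight_def card_cluster[symmetric] by (intro card_mono) auto

lemma weight_all: "i < N \<Longrightarrow> weight {0..<n} i = s"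
proof -
  have "{e \<in> triples n. e \<subseteq> {0..<n} \<and> f e = i} = {e \<in> triples n. f e = i}"
    by (auto simp: triples_def)
  then show "i < N \<Longrightarrow> weight {0..<n} i = s" by (simp add: weight_def card_cluster)
qed

lemma card_induced:
  assumes "finite S"
  shows "card (induced (cluster_graph S) W) = (\<Sum>i\<in>S. weight W i)"
proof -
  have "induced (cluster_graph S) W = (\<Union>i\<in>S. {e \<in> triples n. e \<subseteq> W \<and> f e = i})"
    by (auto simp: induced_def cluster_graph_def)
  also have "card \<dots> = (\<Sum>i\<in>S. weight W i)"
    unfolding weight_def using assms by (intro card_UN_disjoint) auto
  finally show ?thesis .
qed

lemma sum_weight:
  assumes "W \<subseteq> {0..<n}"
  shows "(\<Sum>i<N. weight W i) = card W choose 3"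
proof -
  have "(\<Sum>i<N. weight W i) = card (induced (cluster_graph {..<N}) W)"
    by (simp add: card_induced)
  also have "induced (cluster_graph {..<N}) W = {e. e \<subseteq> W \<and> card e = 3}"
    using assms cluster_less by (auto simp: induced_def cluster_graph_def triples_def)
  also have "card \<dots> = card W choose 3" using assms finite_subset by (intro n_subsets) auto
  finally show ?thesis .
qed

lemma n_choose_3: "n choose 3 = N * s"
proof -
  have "(\<Sum>i<N. weight {0..<n} i) = (\<Sum>i<N. s)"
  proof (rule sum.cong)
    fix i assume "i \<in> {..<N}"
    then have "i < N" by simp
    then show "weight {0..<n} i = s" by (rule weight_all)
  qed simp
  then show ?thesis using sum_weight[of "{0..<n}"] by simp
qed

lemma card_cluster_graph:
  assumes "S \<subseteq> {..<N}"
  shows "card (cluster_graph S) = card S * s"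
proof -
  have fin: "finite S" using assms finite_subset by auto
  have "induced (cluster_graph S) {0..<n} = cluster_graph S"
    by (auto simp: induced_def cluster_graph_def triples_def)
  then have "card (cluster_graph S) = (\<Sum>i\<in>S. weight {0..<n} i)"
    using card_induced[OF fin, of "{0..<n}"] by simp
  also have "\<dots> = (\<Sum>i\<in>S. s)"
  proof (rule sum.cong)
    fix i assume "i \<in> S"
    then have "i < N" using assms by auto
    then show "weight {0..<n} i = s" by (rule weight_all)
  qed simp
  finally show ?thesis by simp
qed

lemma is_3graph_cluster_graph: "is_3graph n (cluster_graph S)"
  by (auto simp: is_3graph_def cluster_graph_def triples_def)

lemma has_density_cluster_graph:
  assumes "S \<subseteq> {..<N}" "real (card S) = p * real N"
  shows "has_density n p (cluster_graph S)"
  using assms by (simp add: has_density_def card_cluster_graph n_choose_3)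

text \<open>Union bound over the at most \<open>2 ^ n\<close> sets \<open>W\<close>. The density is
  exact for every \<open>S\<close> of size \<open>M\<close>, so only the edge count inside some
  \<open>W\<close> can fail. The total weight is \<open>n div 2 choose 3\<close> and each weight is
  at most \<open>s\<close>; their quotient gives the exponent.\<close>

lemma card_not_quasi_random:
  fixes p \<epsilon> :: real
  assumes p: "0 < p" "p < 1" and M: "real M = p * real N" and eps: "0 < \<epsilon>" and n: "3 \<le> n div 2"
    and \<delta>: "\<delta> = min 1 \<epsilon> / 2"
  shows "real (card {S. S \<subseteq> {..<N} \<and> card S = M \<and> \<not> quasi_random \<epsilon> p n (cluster_graph S)})
      \<le> 2 ^ n * (2 * real (N + 1) * exp (- (\<delta> * \<epsilon> / 2 * real (n div 2 choose 3) / real s))) * real (N choose M)"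
    (is "real (card ?bad) \<le> _")
proof -
  define A where "A = real (n div 2 choose 3)"
  have A0: "A > 0" using n by (simp add: A_def zero_less_binomial)
  define \<W> where "\<W> = {W. W \<subseteq> {0..<n} \<and> card W = n div 2}"
  define B where "B W = {S. S \<subseteq> {..<N} \<and> card S = M \<and>
      \<bar>(\<Sum>i\<in>S. real (weight W i)) - p * A\<bar> \<ge> \<epsilon> * A}" for W
  have fW: "finite \<W>" by (auto simp: \<W>_def)
  have fB: "finite (B W)" for W by (auto simp: B_def)
  have "?bad \<subseteq> (\<Union>W\<in>\<W>. B W)"
  proof
    fix S assume "S \<in> ?bad"
    then have S: "S \<subseteq> {..<N}" "card S = M" "\<not> quasi_random \<epsilon> p n (cluster_graph S)" by auto
    have "has_density n p (cluster_graph S)" using S M by (intro has_density_cluster_graph) auto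
    then obtain W where W: "W \<subseteq> {0..<n}" "card W = n div 2" and
      "\<not> (p - \<epsilon> < real (card (induced (cluster_graph S) W)) / real (card W choose 3) \<and>
        real (card (induced (cluster_graph S) W)) / real (card W choose 3) < p + \<epsilon>)"
      using S(3) is_3graph_cluster_graph unfolding quasi_random_def by blast
    then have "\<not> (p - \<epsilon> < (\<Sum>i\<in>S. real (weight W i)) / A \<and> (\<Sum>i\<in>S. real (weight W i)) / A < p + \<epsilon>)"
      using S by (subst (asm) (1 2) card_induced) (auto simp: A_def finite_subset)
    then have "\<bar>(\<Sum>i\<in>S. real (weight W i)) - p * A\<bar> \<ge> \<epsilon> * A"
      using A0 by (simp add: field_simps not_less abs_if) linarith
    then show "S \<in> (\<Union>W\<in>\<W>. B W)" using S W by (auto simp: \<W>_def B_def)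
  qed
  then have "card ?bad \<le> card (\<Union>W\<in>\<W>. B W)" using fW fB by (intro card_mono) auto
  also have "\<dots> \<le> (\<Sum>W\<in>\<W>. card (B W))" using fW by (rule card_UN_le)
  finally have "real (card ?bad) \<le> real (\<Sum>W\<in>\<W>. card (B W))"
    by (rule of_nat_mono)
  also have "\<dots> = (\<Sum>W\<in>\<W>. real (card (B W)))" by simp
  also have "\<dots> \<le> (\<Sum>W\<in>\<W>. 2 * real (N + 1) * real (N choose M) * exp (- (\<delta> * \<epsilon> / 2 * A / real s)))"
  proof (rule sum_mono)
    fix W assume W: "W \<in> \<W>"
    have "A = (\<Sum>i<N. real (weight W i))"
      using W sum_weight[of W] by (simp add: \<W>_def A_def flip: of_nat_sum)
    from card_subsets_deviation[OF _ p _ _ _ _ eps this \<delta>, of M "real s"]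
    show "real (card (B W)) \<le> 2 * real (N + 1) * real (N choose M) * exp (- (\<delta> * \<epsilon> / 2 * A / real s))"
      using M s_pos weight_le by (simp add: B_def)
  qed
  also have "\<dots> = real (card \<W>) * (2 * real (N + 1) * real (N choose M) * exp (- (\<delta> * \<epsilon> / 2 * A / real s)))"
    by simp
  also have "\<dots> \<le> 2 ^ n * (2 * real (N + 1) * real (N choose M) * exp (- (\<delta> * \<epsilon> / 2 * A / real s)))"
  proof (intro mult_right_mono)
    have "card \<W> \<le> card (Pow {0..<n})" by (intro card_mono) (auto simp: \<W>_def)
    then have "card \<W> \<le> 2 ^ n" by (simp add: card_Pow)
    then show "real (card \<W>) \<le> 2 ^ n" by (metis of_nat_le_iff of_nat_numeral of_nat_power)
  qed auto
  finally show ?thesis by (simp add: A_def mult_ac)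
qed

end

section \<open>Orderings and Hamiltonian cycles\<close>

text \<open>The last index below \<open>n\<close> at which a value occurs is never in
  \<open>X\<close>, since an index in \<open>X\<close> is followed by one with the same value. Hence
  the indices outside \<open>X\<close> already give all values.\<close>

lemma card_image_le_diff:
  fixes g :: "nat \<Rightarrow> 'a"
  assumes "X \<subseteq> {i. Suc i < n \<and> g i = g (Suc i)}"
  shows "card (g ` {..<n}) \<le> n - card X"
proof -
  have "g ` {..<n} \<subseteq> g ` ({..<n} - X)"
  proof (rule image_subsetI)
    fix j assume j: "j \<in> {..<n}"
    define J where "J = {i. i < n \<and> g i = g j}"
    have J: "finite J" "J \<noteq> {}" using j by (auto simp: J_def)
    have "Max J \<in> J" using J by (rule Max_in)
    moreover have "Max J \<notin> X"
    proof
      assume "Max J \<in> X"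
      then have "Suc (Max J) \<in> J" using assms \<open>Max J \<in> J\<close> by (auto simp: J_def)
      then have "Suc (Max J) \<le> Max J" using J(1) by (intro Max_ge)
      then show False by simp
    qed
    ultimately show "g j \<in> g ` ({..<n} - X)"
      by (intro image_eqI[of _ _ "Max J"]) (auto simp: J_def)
  qed
  then have "card (g ` {..<n}) \<le> card ({..<n} - X)"
    by (rule surj_card_le[rotated]) simp
  also have "\<dots> = n - card X"
  proof -
    have "X \<subseteq> {..<n}" using assms by auto
    then show ?thesis by (simp add: card_Diff_subset finite_subset)
  qed
  finally show ?thesis .
qed

text \<open>Cauchy-Schwarz for the fibre sizes of \<open>g\<close>, whose squares add up to the
  number of pairs.\<close>

lemma card_pairs_eq_ge:
  assumes A: "finite A"
  shows "(card A)\<^sup>2 \<le> card (g ` A) * card {(a, d). a \<in> A \<and> d \<in> A \<and> g a = g d}"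
proof (cases "A = {}")
  case False
  define F where "F y = {a \<in> A. g a = y}" for y
  have fF: "finite (F y)" for y using A by (simp add: F_def)
  have k: "0 < card (g ` A)" using False A by (simp add: card_gt_0_iff)
  define t where "t = real (card A) / real (card (g ` A))"
  have tk: "t * real (card (g ` A)) = real (card A)" using k by (simp add: t_def)
  have A_eq: "card A = (\<Sum>y\<in>g ` A. card (F y))"
  proof -
    have "A = (\<Union>y\<in>g ` A. F y)" by (auto simp: F_def)
    also have "card \<dots> = (\<Sum>y\<in>g ` A. card (F y))"
      using A fF by (intro card_UN_disjoint) (auto simp: F_def)
    finally show ?thesis .
  qed
  have "{(a, d). a \<in> A \<and> d \<in> A \<and> g a = g d} = (\<Union>y\<in>g ` A. F y \<times> F y)"
    by (auto simp: F_def)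
  also have "card \<dots> = (\<Sum>y\<in>g ` A. card (F y \<times> F y))"
    using A fF by (intro card_UN_disjoint) (auto simp: F_def)
  finally have "real (card {(a, d). a \<in> A \<and> d \<in> A \<and> g a = g d}) = (\<Sum>y\<in>g ` A. (real (card (F y)))\<^sup>2)"
    by (simp add: card_cartesian_product power2_eq_square)
  \<comment> \<open>The tangent to the square function at the average fibre size \<open>t\<close>
    lies below it.\<close>
  also have "\<dots> \<ge> (\<Sum>y\<in>g ` A. 2 * t * real (card (F y)) - t\<^sup>2)"
  proof (rule sum_mono)
    show "2 * t * x - t\<^sup>2 \<le> x\<^sup>2" for x :: real
      using zero_le_power2[of "x - t"] by (simp add: power2_eq_square algebra_simps)
  qed
  also have "(\<Sum>y\<in>g ` A. 2 * t * real (card (F y)) - t\<^sup>2) = 2 * t * real (card A) - t * (t * real (card (g ` A)))"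
    unfolding A_eq by (simp add: sum_subtractf sum_distrib_left power2_eq_square)
  also have "\<dots> = t * real (card A)" by (simp add: tk)
  finally have "t * real (card A) * real (card (g ` A))
      \<le> real (card {(a, d). a \<in> A \<and> d \<in> A \<and> g a = g d}) * real (card (g ` A))"
    by (intro mult_right_mono) auto
  moreover have "t * real (card A) * real (card (g ` A)) = real ((card A)\<^sup>2)"
    using tk by (simp add: power2_eq_square mult_ac)
  ultimately have "real ((card A)\<^sup>2)
      \<le> real (card (g ` A) * card {(a, d). a \<in> A \<and> d \<in> A \<and> g a = g d})"
    by (simp add: mult.commute)
  then show ?thesis by (simp only: of_nat_le_iff)
qed simp

text \<open>Rotation by \<open>n - i\<close> moves the first four entries to the positions
  \<open>i\<close> to \<open>i + 3\<close> and is injective, so every window can be reduced to the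
  first one.\<close>

lemma card_orderings_window:
  fixes Q :: "nat \<Rightarrow> nat \<Rightarrow> nat \<Rightarrow> nat \<Rightarrow> bool"
  assumes i: "i + 3 < n"
  shows "card {vs \<in> permutations_of_set {0..<n}. Q (vs ! 0) (vs ! 1) (vs ! 2) (vs ! 3)}
      \<le> card {vs \<in> permutations_of_set {0..<n}. Q (vs ! i) (vs ! (i + 1)) (vs ! (i + 2)) (vs ! (i + 3))}"
    (is "card ?A \<le> card ?B")
proof (rule card_inj_on_le[where f = "rotate (n - i)"])
  have len: "length vs = n" if "vs \<in> permutations_of_set {0..<n}" for vs
    using length_finite_permutations_of_set[OF that] by simp
  show "inj_on (rotate (n - i)) ?A"
  proof (rule inj_on_inverseI[where g = "rotate i"])
    fix vs assume "vs \<in> ?A"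
    then have "length vs = n" using len by auto
    then show "rotate i (rotate (n - i) vs) = vs"
      using i rotate_length01 by (simp add: rotate_rotate)
  qed
  show "rotate (n - i) ` ?A \<subseteq> ?B"
  proof (rule image_subsetI)
    fix vs assume vs: "vs \<in> ?A"
    have nth: "rotate (n - i) vs ! (i + k) = vs ! k" if "k \<le> 3" for k
      using that i len vs by (subst nth_rotate) auto
    have "rotate (n - i) vs \<in> permutations_of_set {0..<n}"
      using vs by (auto simp: permutations_of_set_def)
    then show "rotate (n - i) vs \<in> ?B"
      using vs nth[of 0] nth[of 1] nth[of 2] nth[of 3] by simp
  qed
  show "finite ?B" by simp
qed

text \<open>An admissible quadruple can be continued by any ordering of the remaining
  \<open>n - 4\<close> vertices.\<close>

lemma card_orderings_first_four:
  fixes Q :: "nat \<Rightarrow> nat \<Rightarrow> nat \<Rightarrow> nat \<Rightarrow> bool"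
  shows "card {(a, b, c, d). {a, b, c, d} \<subseteq> {0..<n} \<and> distinct [a, b, c, d] \<and> Q a b c d} * fact (n - 4)
      \<le> card {vs \<in> permutations_of_set {0..<n}. Q (vs ! 0) (vs ! 1) (vs ! 2) (vs ! 3)}"
proof -
  define Z where "Z = {(a, b, c, d). {a, b, c, d} \<subseteq> {0..<n} \<and> distinct [a, b, c, d] \<and> Q a b c d}"
  define R where "R = (\<lambda>(a, b, c, d). permutations_of_set ({0..<n} - {a, b, c, d}))"
  define \<phi> where "\<phi> = (\<lambda>((a, b, c, d), ws). a # b # c # d # (ws :: nat list))"
  have "finite Z"
    by (rule finite_subset[of _ "{0..<n} \<times> {0..<n} \<times> {0..<n} \<times> {0..<n}"]) (auto simp: Z_def)
  moreover have "finite (R z)" for z by (auto simp: R_def split: prod.splits)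
  ultimately have "card (Sigma Z R) = (\<Sum>z\<in>Z. card (R z))" by (intro card_SigmaI) auto
  also have "\<dots> = (\<Sum>z\<in>Z. fact (n - 4))"
  proof (rule sum.cong)
    fix z assume "z \<in> Z"
    then obtain a b c d where z: "z = (a, b, c, d)" "{a, b, c, d} \<subseteq> {0..<n}" "distinct [a, b, c, d]"
      by (auto simp: Z_def)
    have "card {a, b, c, d} = 4" using z(3) by simp
    then have "card ({0..<n} - {a, b, c, d}) = n - 4"
      using card_Diff_subset[OF _ z(2)] by (simp del: Diff_insert Diff_insert2)
    then show "card (R z) = fact (n - 4)"
      unfolding R_def z(1) prod.case
      by (subst card_permutations_of_set) (simp_all only: finite_Diff finite_atLeastLessThan)
  qed simp
  finally have "card Z * fact (n - 4) = card (Sigma Z R)" by simp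
  also have "\<dots> \<le> card {vs \<in> permutations_of_set {0..<n}. Q (vs ! 0) (vs ! 1) (vs ! 2) (vs ! 3)}"
  proof (rule card_inj_on_le[where f = \<phi>])
    show "inj_on \<phi> (Sigma Z R)" by (auto simp: inj_on_def \<phi>_def)
    show "\<phi> ` Sigma Z R \<subseteq> {vs \<in> permutations_of_set {0..<n}. Q (vs ! 0) (vs ! 1) (vs ! 2) (vs ! 3)}"
    proof (rule image_subsetI)
      fix x assume "x \<in> Sigma Z R"
      then obtain a b c d ws where x: "x = ((a, b, c, d), ws)"
        and z: "{a, b, c, d} \<subseteq> {0..<n}" "distinct [a, b, c, d]" "Q a b c d"
        and ws: "set ws = {0..<n} - {a, b, c, d}" "distinct ws"
        by (auto simp: Z_def R_def permutations_of_set_def simp del: Diff_insert Diff_insert2)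
      have "set (\<phi> x) = {a, b, c, d} \<union> set ws" by (simp add: x \<phi>_def insert_commute)
      then have "set (\<phi> x) = {0..<n}" using z(1) ws(1) by blast
      moreover have "distinct (\<phi> x)"
      proof -
        have "a \<notin> set ws" "b \<notin> set ws" "c \<notin> set ws" "d \<notin> set ws" using ws(1) by blast+
        then show ?thesis using z(2) ws(2) by (simp add: x \<phi>_def)
      qed
      ultimately show "\<phi> x \<in> {vs \<in> permutations_of_set {0..<n}. Q (vs ! 0) (vs ! 1) (vs ! 2) (vs ! 3)}"
        using z(3) by (simp add: permutations_of_set_def x \<phi>_def)
    qed
  qed simp
  finally show ?thesis by (simp only: Z_def)
qed

section \<open>Recovering an ordering from its cycle\<close>

lemma cycle_edges_altdef:
  "cycle_edges vs = (\<lambda>i. {vs ! i, vs ! ((i + 1) mod length vs), vs ! ((i + 2) mod length vs)}) ` {..<length vs}"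
  unfolding cycle_edges_def Let_def image_Collect[symmetric] lessThan_def by (rule refl)

text \<open>Only the edges that start at positions \<open>i\<close> and \<open>i + 1\<close> contain
  both \<open>vs ! (i + 1)\<close> and \<open>vs ! (i + 2)\<close>. Their third vertices are
  \<open>vs ! i\<close>, which is excluded, and \<open>vs ! (i + 3)\<close>.\<close>

lemma cycle_edge_next:
  assumes vs: "distinct vs" "length vs = n" and i: "i + 3 < n"
    and e: "{vs ! (i + 1), vs ! (i + 2), w} \<in> cycle_edges vs"
    and w: "w \<noteq> vs ! i" "w \<noteq> vs ! (i + 1)" "w \<noteq> vs ! (i + 2)"
  shows "w = vs ! (i + 3)"
proof -
  obtain j where j: "j < n" and
    eq: "{vs ! (i + 1), vs ! (i + 2), w} = {vs ! j, vs ! ((j + 1) mod n), vs ! ((j + 2) mod n)}"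
    using e vs by (auto simp: cycle_edges_altdef)
  have mem: "x \<in> {j, (j + 1) mod n, (j + 2) mod n}" if "x < n" "vs ! x \<in> {vs ! (i + 1), vs ! (i + 2), w}" for x
    using that vs j nth_eq_iff_index_eq[OF vs(1), of x] unfolding eq by auto
  have 1: "i + 1 \<in> {j, (j + 1) mod n, (j + 2) mod n}" and 2: "i + 2 \<in> {j, (j + 1) mod n, (j + 2) mod n}"
    using mem i by auto
  \<comment> \<open>The edge that starts at \<open>j\<close> stays inside the list, wraps around
    with one vertex, or wraps around with two.\<close>
  consider "j + 2 < n" | "j + 2 = n" | "j + 1 = n" using j by linarith
  then have "j = i \<or> j = i + 1"
  proof cases
    case 1
    then show ?thesis using \<open>i + 1 \<in> _\<close> 2 i by auto
  next
    case 2
    then have "(j + 1) mod n = n - 1" "(j + 2) mod n = 0" by auto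
    then show ?thesis using \<open>i + 1 \<in> _\<close> \<open>i + 2 \<in> _\<close> 2 i by auto
  next
    case 3
    then have "(j + 1) mod n = 0" "(j + 2) mod n = 1" using i by (auto simp: mod_if)
    then show ?thesis using \<open>i + 1 \<in> _\<close> \<open>i + 2 \<in> _\<close> 3 i by auto
  qed
  moreover have False if "j = i"
    using eq w that i by (auto simp: doubleton_eq_iff insert_eq_iff)
  ultimately have "j = i + 1" by auto
  then show ?thesis using eq w i by (auto simp: doubleton_eq_iff insert_eq_iff numeral_3_eq_3)
qed

text \<open>Once three consecutive vertices agree, the next edge of \<open>ws\<close> is also an
  edge of \<open>vs\<close>, and \<open>cycle_edge_next\<close> determines its new vertex. Hence a
  cycle comes from at most \<open>n ^ 3\<close> orderings.\<close>

lemma cycle_edges_inject: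
  assumes vs: "distinct vs" "length vs = n" and ws: "distinct ws" "length ws = n" and n: "3 \<le> n"
    and eq: "cycle_edges vs = cycle_edges ws"
    and start: "vs ! 0 = ws ! 0" "vs ! 1 = ws ! 1" "vs ! 2 = ws ! 2"
  shows "vs = ws"
proof (rule nth_equalityI)
  fix k assume "k < length vs"
  then have "k < n" using vs by simp
  then show "vs ! k = ws ! k"
  proof (induction k rule: less_induct)
    case (less k)
    consider "k = 0" | "k = 1" | "k = 2" | "k = (k - 3) + 3" by linarith
    then show ?case
    proof cases
      case 4
      then obtain i where 4: "k = i + 3" by blast
      have IH: "vs ! i = ws ! i" "vs ! (i + 1) = ws ! (i + 1)" "vs ! (i + 2) = ws ! (i + 2)"
        using less 4 by auto
      have k: "i + 3 < n" using less 4 by simp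
      have "{ws ! (i + 1), ws ! (i + 2), ws ! (i + 3)} \<in> cycle_edges ws"
        unfolding cycle_edges_altdef
        by (rule image_eqI[of _ _ "i + 1"]) (use k ws in \<open>auto simp: numeral_3_eq_3\<close>)
      then have "ws ! (i + 3) = vs ! (i + 3)"
        using vs k
      proof (intro cycle_edge_next)
        show "ws ! (i + 3) \<noteq> vs ! i" "ws ! (i + 3) \<noteq> vs ! (i + 1)" "ws ! (i + 3) \<noteq> vs ! (i + 2)"
          using IH k ws by (auto simp: nth_eq_iff_index_eq)
      qed (use eq IH in auto)
      then show ?thesis using 4 by simp
    qed (use start in auto)
  qed
qed (simp only: vs ws)

text \<open>A bound on the family of cycles that is uniform in \<open>G\<close>; it gives the
  boundedness under which the supremum in \<open>H3\<close> is an upper bound.\<close>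

lemma ham_cycles_subset:
  assumes "0 < n"
  shows "ham_cycles n G \<subseteq> Pow (Pow {0..<n})"
proof -
  have "cycle_edges vs \<subseteq> Pow {0..<n}" if vs: "distinct vs" "set vs = {0..<n}" for vs
  proof -
    have "length vs = n" using vs distinct_card by fastforce
    moreover have "vs ! i \<in> {0..<n}" if "i < n" for i
      using nth_mem[of i vs] that \<open>length vs = n\<close> vs by simp
    ultimately show ?thesis
      unfolding cycle_edges_altdef using assms
      by (intro image_subsetI) (simp del: atLeastLessThan_iff)
  qed
  then show ?thesis by (auto simp: ham_cycles_def)
qed

lemma card_orderings_le_H:
  assumes n: "3 \<le> n"
  shows "card {vs \<in> permutations_of_set {0..<n}. cycle_edges vs \<subseteq> G} \<le> H n G * n ^ 3"
proof -
  define L where "L = {vs \<in> permutations_of_set {0..<n}. cycle_edges vs \<subseteq> G}"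
  define \<psi> where "\<psi> vs = (cycle_edges vs, vs ! 0, vs ! 1, vs ! 2)" for vs :: "nat list"
  have L: "distinct vs" "length vs = n" "set vs = {0..<n}" "cycle_edges vs \<subseteq> G" if "vs \<in> L" for vs
    using that length_finite_permutations_of_set[of vs "{0..<n}"]
    by (auto simp: L_def permutations_of_set_def)
  have "card L \<le> card (ham_cycles n G \<times> {0..<n} \<times> {0..<n} \<times> {0..<n})"
  proof (rule card_inj_on_le[where f = \<psi>])
    show "inj_on \<psi> L"
      by (intro inj_onI cycle_edges_inject[OF L(1,2) L(1,2) n]) (auto simp: \<psi>_def)
    show "\<psi> ` L \<subseteq> ham_cycles n G \<times> {0..<n} \<times> {0..<n} \<times> {0..<n}"
    proof (rule image_subsetI)
      fix vs assume vs: "vs \<in> L"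
      have "vs ! i \<in> {0..<n}" if "i < n" for i using nth_mem[of i vs] that L[OF vs] by simp
      moreover have "cycle_edges vs \<in> ham_cycles n G"
        unfolding ham_cycles_def using L[OF vs] by blast
      ultimately show "\<psi> vs \<in> ham_cycles n G \<times> {0..<n} \<times> {0..<n} \<times> {0..<n}"
        using n by (simp add: \<psi>_def)
    qed
    show "finite (ham_cycles n G \<times> {0..<n} \<times> {0..<n} \<times> {0..<n})"
      using ham_cycles_subset[of n G] n by (auto intro: finite_subset)
  qed
  then show ?thesis by (simp add: L_def H_def card_cartesian_product power3_eq_cube)
qed

lemma H_le_H3:
  assumes "0 < n" "quasi_random \<epsilon> p n G"
  shows "H n G \<le> H3 n p \<epsilon>"
  unfolding H3_def
proof (rule cSup_upper)
  show "H n G \<in> {H n G |G. quasi_random \<epsilon> p n G}" using assms by auto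
  have "H n G' \<le> card (Pow (Pow {0..<n}))" for G'
    unfolding H_def using ham_cycles_subset[OF assms(1)] by (intro card_mono) auto
  then show "bdd_above {H n G |G. quasi_random \<epsilon> p n G}" by (intro bdd_aboveI) auto
qed

section \<open>Counting cycles in a random union of clusters\<close>

lemma Suc_coincidence:
  assumes "length vs = n" "i + 3 < n"
  shows "{vs ! i, vs ! ((i + 1) mod n), vs ! ((i + 2) mod n)} = {vs ! i, vs ! (i + 1), vs ! (i + 2)}"
    "{vs ! Suc i, vs ! ((Suc i + 1) mod n), vs ! ((Suc i + 2) mod n)} = {vs ! (i + 1), vs ! (i + 2), vs ! (i + 3)}"
  using assms by (simp_all add: numeral_3_eq_3)

text \<open>Pairs of consecutive edges in a common cluster, indexed by the first edge. Leaving out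
  the three pairs that wrap around the list removes \<open>mod\<close> and makes every position an
  instance of the same window of four vertices.\<close>

definition coincidences :: "(nat set \<Rightarrow> nat) \<Rightarrow> nat list \<Rightarrow> nat set" where
  "coincidences f vs = {i. i + 3 < length vs \<and>
     f {vs ! i, vs ! (i + 1), vs ! (i + 2)} = f {vs ! (i + 1), vs ! (i + 2), vs ! (i + 3)}}"

text \<open>At a coincidence the next edge repeats the cluster of the current one, so each
  coincidence saves one cluster.\<close>

lemma card_image_cycle_edges_le:
  "card (f ` cycle_edges vs) \<le> length vs - card (coincidences f vs)"
proof -
  define g where "g i = f {vs ! i, vs ! ((i + 1) mod length vs), vs ! ((i + 2) mod length vs)}" for i
  have "f ` cycle_edges vs = g ` {..<length vs}"
    by (simp add: cycle_edges_altdef g_def image_image)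
  moreover have "coincidences f vs \<subseteq> {i. Suc i < length vs \<and> g i = g (Suc i)}"
  proof
    fix i assume i: "i \<in> coincidences f vs"
    then have "i + 3 < length vs" by (simp add: coincidences_def)
    then have "g i = g (Suc i)"
      unfolding g_def Suc_coincidence[OF refl \<open>i + 3 < length vs\<close>] using i by (simp add: coincidences_def)
    then show "i \<in> {i. Suc i < length vs \<and> g i = g (Suc i)}" using \<open>i + 3 < length vs\<close> by simp
  qed
  ultimately show ?thesis using card_image_le_diff by metis
qed

lemma cycle_edges_triples:
  assumes vs: "vs \<in> permutations_of_set {0..<n}" and n: "3 \<le> n"
  shows "cycle_edges vs \<subseteq> triples n"
proof -
  have vs': "distinct vs" "length vs = n" "set vs = {0..<n}"
    using vs length_finite_permutations_of_set[OF vs] by (auto simp: permutations_of_set_def)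
  show ?thesis
    unfolding cycle_edges_altdef
  proof (rule image_subsetI)
    fix i assume "i \<in> {..<length vs}"
    then have i: "i < n" using vs' by simp
    define j k where "j = (i + 1) mod n" and "k = (i + 2) mod n"
    have jk: "j < n" "k < n" using n by (auto simp: j_def k_def)
    consider "i + 2 < n" | "i + 2 = n" | "i + 1 = n" using i by linarith
    then have ne: "i \<noteq> j \<and> j \<noteq> k \<and> i \<noteq> k"
    proof cases
      case 3
      then have "j = 0" "k = 1" using n by (auto simp: j_def k_def mod_if)
      then show ?thesis using 3 n by auto
    qed (use n in \<open>auto simp: j_def k_def\<close>)
    then have "card {vs ! i, vs ! j, vs ! k} = 3"
      using i jk vs' by (simp add: nth_eq_iff_index_eq)
    moreover have "vs ! x \<in> {0..<n}" if "x < n" for x using nth_mem[of x vs] that vs' by simp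
    then have "{vs ! i, vs ! j, vs ! k} \<subseteq> {0..<n}" using i jk by blast
    ultimately show "{vs ! i, vs ! ((i + 1) mod length vs), vs ! ((i + 2) mod length vs)} \<in> triples n"
      unfolding triples_def using vs' by (simp add: j_def k_def)
  qed
qed

text \<open>\<open>cluster_graph S\<close> contains the cycle iff \<open>S\<close> contains all
  clusters that the cycle meets, and with \<open>x\<close> coincidences these are at most
  \<open>n - x\<close>. The condition \<open>2 * n\<^sup>2 \<le> M\<close> makes the correction 1 -
  k^2 / M at least 1 / 2.\<close>

lemma (in triple_clustering) card_containing_cycle_ge:
  fixes p :: real
  assumes p: "0 < p" "p < 1" and M: "real M = p * real N" and n: "3 \<le> n"
    and nM: "2 * real (n\<^sup>2) \<le> real M" and vs: "vs \<in> permutations_of_set {0..<n}"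
  shows "p ^ n / 2 * (1 / p) ^ card (coincidences f vs) * real (N choose M)
      \<le> real (card {S. S \<subseteq> {..<N} \<and> card S = M \<and> cycle_edges vs \<subseteq> cluster_graph S})"
proof -
  define K where "K = f ` cycle_edges vs"
  define k where "k = card K"
  define x where "x = card (coincidences f vs)"
  have len: "length vs = n" using length_finite_permutations_of_set[OF vs] by simp
  have "coincidences f vs \<subseteq> {..<n}" using len by (auto simp: coincidences_def)
  then have x: "x \<le> n" unfolding x_def using card_mono[of "{..<n}"] by fastforce
  have k: "k \<le> n - x" using card_image_cycle_edges_le[of f vs] len by (simp add: k_def K_def x_def)
  have T: "cycle_edges vs \<subseteq> triples n" using vs n by (rule cycle_edges_triples)
  have K: "K \<subseteq> {..<N}" using T cluster_less by (auto simp: K_def)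
  have "real (k\<^sup>2) \<le> real (n\<^sup>2)" using k by (intro of_nat_mono power_mono) auto
  then have k2: "2 * real (k\<^sup>2) \<le> real M" using nM by linarith
  have "real k \<le> real (k\<^sup>2)" by (intro of_nat_mono) (simp add: power2_eq_square)
  then have "real k \<le> real M" using k2 by linarith
  then have kM: "k \<le> M" by simp
  have Mpos: "real M > 0"
  proof -
    have "0 < real (n\<^sup>2)" using n by simp
    then show ?thesis using nM by linarith
  qed
  have "p ^ n * (1 / p) ^ x = p ^ (n - x)"
    using x p by (simp add: power_diff power_one_over divide_simps)
  also have "\<dots> \<le> p ^ k" using k p by (intro power_decreasing) auto
  finally have "p ^ n * (1 / p) ^ x \<le> p ^ k" .
  then have "p ^ n / 2 * (1 / p) ^ x \<le> p ^ k * (1 / 2)" by simp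
  also have "\<dots> \<le> p ^ k * (1 - real (k\<^sup>2) / real M)"
    using k2 Mpos p by (intro mult_left_mono) (auto simp: field_simps)
  finally have "p ^ n / 2 * (1 / p) ^ x * real (N choose M)
      \<le> p ^ k * (1 - real (k\<^sup>2) / real M) * real (N choose M)"
    by (intro mult_right_mono) auto
  also have "\<dots> \<le> real (N - k choose (M - k))"
    using p M kM by (rule binomial_diff_ge)
  also have "N - k choose (M - k) = card {S. S \<subseteq> {..<N} \<and> card S = M \<and> K \<subseteq> S}"
    using card_supersets[of "{..<N}" K M] K kM by (simp add: k_def)
  also have "{S. S \<subseteq> {..<N} \<and> card S = M \<and> K \<subseteq> S}
      = {S. S \<subseteq> {..<N} \<and> card S = M \<and> cycle_edges vs \<subseteq> cluster_graph S}"
    using T by (auto simp: K_def cluster_graph_def)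
  finally show ?thesis by (simp add: x_def)
qed

text \<open>Jensen's inequality for the exponential function with base \<open>y\<close>, by the
  tangent at \<open>\<mu>\<close>: the linear terms have a nonnegative sum by the assumption on the
  average.\<close>

lemma sum_power_ge:
  fixes y \<mu> :: real and x :: "'a \<Rightarrow> nat"
  assumes y: "1 \<le> y" and \<mu>: "\<mu> * real (card A) \<le> (\<Sum>a\<in>A. real (x a))"
  shows "y powr \<mu> * real (card A) \<le> (\<Sum>a\<in>A. y ^ x a)"
proof -
  define l where "l = ln y"
  have l: "l \<ge> 0" using y by (simp add: l_def)
  have "y powr \<mu> * real (card A) \<le> y powr \<mu> * (real (card A) + l * ((\<Sum>a\<in>A. real (x a)) - \<mu> * real (card A)))"
    using l \<mu> by (intro mult_left_mono) auto
  also have "\<dots> = (\<Sum>a\<in>A. y powr \<mu> * (1 + (real (x a) - \<mu>) * l))"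
    by (simp add: sum_distrib_left[symmetric] sum.distrib sum_distrib_right[symmetric] sum_subtractf algebra_simps)
  also have "\<dots> \<le> (\<Sum>a\<in>A. y ^ x a)"
  proof (rule sum_mono)
    fix a assume "a \<in> A"
    have "y powr \<mu> * (1 + (real (x a) - \<mu>) * l) \<le> y powr \<mu> * exp ((real (x a) - \<mu>) * l)"
      by (intro mult_left_mono exp_ge_add_one_self) auto
    also have "\<dots> = exp (\<mu> * l + (real (x a) - \<mu>) * l)"
      using y by (simp add: powr_def l_def exp_add)
    also have "\<mu> * l + (real (x a) - \<mu>) * l = real (x a) * l" by (simp add: algebra_simps)
    also have "exp (real (x a) * l) = y ^ x a"
      using y by (simp add: exp_of_nat_mult l_def)
    finally show "y powr \<mu> * (1 + (real (x a) - \<mu>) * l) \<le> y ^ x a" .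
  qed
  finally show ?thesis .
qed

text \<open>Double counting of pairs of a choice \<open>S\<close> and an ordering whose cycle lies
  in \<open>cluster_graph S\<close>. The lower bound comes from the probability of each cycle and
  convexity; the upper bound is at most \<open>n ^ 3 * H3 n p \<epsilon>\<close> for each
  quasi-random choice.\<close>

lemma (in triple_clustering) H3_ge:
  fixes p \<epsilon> \<mu> :: real
  assumes p: "0 < p" "p < 1" and M: "real M = p * real N" and eps: "0 < \<epsilon>" and n: "6 \<le> n"
    and nM: "2 * real (n\<^sup>2) \<le> real M" and \<delta>: "\<delta> = min 1 \<epsilon> / 2"
    and bad: "2 ^ n * (2 * real (N + 1) * exp (- (\<delta> * \<epsilon> / 2 * real (n div 2 choose 3) / real s))) \<le> p ^ n / 4"
    and \<mu>: "0 \<le> \<mu>" "\<mu> * fact n \<le> (\<Sum>vs\<in>permutations_of_set {0..<n}. real (card (coincidences f vs)))"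
  shows "p ^ n * (1 / p) powr \<mu> * fact n / 4 \<le> real n ^ 3 * real (H3 n p \<epsilon>)"
proof -
  define L where "L = permutations_of_set {0..<n}"
  have cardL: "real (card L) = fact n" by (simp add: L_def)
  define SS where "SS = {S. S \<subseteq> {..<N} \<and> card S = M}"
  define BB where "BB = {S. S \<subseteq> {..<N} \<and> card S = M \<and> \<not> quasi_random \<epsilon> p n (cluster_graph S)}"
  define C where "C = real (N choose M)"
  define c where "c S = card {vs \<in> L. cycle_edges vs \<subseteq> cluster_graph S}" for S
  have fSS: "finite SS" by (auto simp: SS_def)
  have BB: "BB \<subseteq> SS" by (auto simp: BB_def SS_def)
  have MN: "M \<le> N"
    using M p by (metis mult_left_le_one_le of_nat_0_le_iff of_nat_le_iff less_imp_le)
  have C0: "C > 0" using MN by (simp add: C_def zero_less_binomial)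
  have cardSS: "real (card SS) = C"
    unfolding SS_def C_def using n_subsets[of "{..<N}" M] by simp
  have "(\<Sum>S\<in>SS. real (c S)) = (\<Sum>S\<in>SS. \<Sum>vs\<in>L. of_bool (cycle_edges vs \<subseteq> cluster_graph S))"
    by (intro sum.cong refl) (simp add: c_def L_def Int_def)
  also have "\<dots> = (\<Sum>vs\<in>L. \<Sum>S\<in>SS. of_bool (cycle_edges vs \<subseteq> cluster_graph S))"
    by (rule sum.swap)
  also have "\<dots> = (\<Sum>vs\<in>L. real (card {S. S \<subseteq> {..<N} \<and> card S = M \<and> cycle_edges vs \<subseteq> cluster_graph S}))"
    using fSS by (intro sum.cong refl) (simp add: SS_def Int_def conj_assoc)
  finally have swap: "(\<Sum>S\<in>SS. real (c S))
      = (\<Sum>vs\<in>L. real (card {S. S \<subseteq> {..<N} \<and> card S = M \<and> cycle_edges vs \<subseteq> cluster_graph S}))" .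
  have "p ^ n / 2 * C * ((1 / p) powr \<mu> * real (card L))
      \<le> p ^ n / 2 * C * (\<Sum>vs\<in>L. (1 / p) ^ card (coincidences f vs))"
    using p C0 \<mu> by (intro mult_left_mono sum_power_ge) (auto simp: L_def)
  also have "\<dots> = (\<Sum>vs\<in>L. p ^ n / 2 * (1 / p) ^ card (coincidences f vs) * C)"
    by (simp add: sum_distrib_left mult_ac)
  also have "\<dots> \<le> (\<Sum>S\<in>SS. real (c S))"
    unfolding swap C_def using n
    by (intro sum_mono card_containing_cycle_ge[OF p M _ nM]) (auto simp: L_def)
  \<comment> \<open>For choices that are not quasi-random the trivial count of all orderings is
    enough, because \<open>bad\<close> makes them at most a fraction \<open>p ^ n / 4\<close> of all
    choices.\<close>
  also have "\<dots> = (\<Sum>S\<in>SS - BB. real (c S)) + (\<Sum>S\<in>BB. real (c S))"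
    using fSS BB by (rule sum.subset_diff[rotated])
  also have "(\<Sum>S\<in>SS - BB. real (c S)) \<le> (\<Sum>S\<in>SS - BB. real n ^ 3 * real (H3 n p \<epsilon>))"
  proof (rule sum_mono)
    fix S assume "S \<in> SS - BB"
    then have "quasi_random \<epsilon> p n (cluster_graph S)" by (auto simp: SS_def BB_def)
    then have "H n (cluster_graph S) \<le> H3 n p \<epsilon>" using n by (intro H_le_H3) auto
    moreover have "c S \<le> H n (cluster_graph S) * n ^ 3"
      unfolding c_def L_def using n by (intro card_orderings_le_H) auto
    ultimately have "c S \<le> n ^ 3 * H3 n p \<epsilon>"
      by (metis le_trans mult.commute mult_le_mono1)
    then show "real (c S) \<le> real n ^ 3 * real (H3 n p \<epsilon>)"
      by (metis of_nat_le_iff of_nat_mult of_nat_power)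
  qed
  also have "\<dots> \<le> C * (real n ^ 3 * real (H3 n p \<epsilon>))"
  proof -
    have "real (card (SS - BB)) \<le> C"
      unfolding cardSS[symmetric] using fSS by (intro of_nat_mono card_mono) auto
    then show ?thesis by (simp add: mult_right_mono)
  qed
  also have "(\<Sum>S\<in>BB. real (c S)) \<le> (\<Sum>S\<in>BB. real (card L))"
    unfolding c_def by (intro sum_mono of_nat_mono card_mono) (auto simp: L_def)
  also have "\<dots> = real (card BB) * fact n" by (simp add: cardL)
  also have "\<dots> \<le> p ^ n / 4 * C * fact n"
  proof (rule mult_right_mono)
    have "real (card BB) \<le> 2 ^ n * (2 * real (N + 1) * exp (- (\<delta> * \<epsilon> / 2 * real (n div 2 choose 3) / real s))) * C"
      unfolding BB_def C_def using n by (intro card_not_quasi_random p M eps \<delta>) auto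
    also have "\<dots> \<le> p ^ n / 4 * C" using bad C0 by (intro mult_right_mono) auto
    finally show "real (card BB) \<le> p ^ n / 4 * C" .
  qed simp
  finally have "C * (p ^ n / 2 * (1 / p) powr \<mu> * fact n)
      \<le> C * (real n ^ 3 * real (H3 n p \<epsilon>) + p ^ n / 4 * fact n)"
    by (simp add: cardL algebra_simps)
  then have *: "p ^ n / 2 * (1 / p) powr \<mu> * fact n \<le> real n ^ 3 * real (H3 n p \<epsilon>) + p ^ n / 4 * fact n"
    using C0 by simp
  \<comment> \<open>Since \<open>\<mu>\<close> is nonnegative, the bad choices take away at most
    half of the main term; this turns the factor 1 / 2 into 1 / 4.\<close>
  have "1 \<le> (1 / p) powr \<mu>" using p \<mu> by (intro ge_one_powr_ge_zero) auto
  then have le: "p ^ n / 4 * fact n * 1 \<le> p ^ n / 4 * fact n * (1 / p) powr \<mu>"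
    using p by (intro mult_left_mono) auto
  define X where "X = p ^ n * (1 / p) powr \<mu> * fact n"
  have "p ^ n / 2 * (1 / p) powr \<mu> * fact n = X / 2" "p ^ n / 4 * fact n * (1 / p) powr \<mu> = X / 4"
    by (simp_all add: X_def)
  with * le have "X / 4 \<le> real n ^ 3 * real (H3 n p \<epsilon>)" by linarith
  then show ?thesis by (simp only: X_def)
qed

section \<open>Coincidences in the rank clustering\<close>

text \<open>Linearity over the \<open>n - 3\<close> windows: each of them shows the admissible
  quadruples in at least \<open>fact (n - 4)\<close> orderings per quadruple.\<close>

lemma sum_coincidences_ge:
  assumes n: "4 \<le> n"
  shows "(n - 3) * (card {(a, b, c, d). {a, b, c, d} \<subseteq> {0..<n} \<and> distinct [a, b, c, d]
            \<and> f {a, b, c} = f {b, c, d}} * fact (n - 4))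
      \<le> (\<Sum>vs\<in>permutations_of_set {0..<n}. card (coincidences f vs))"
proof -
  define L where "L = permutations_of_set {0..<n}"
  define Q where "Q = (\<lambda>a b c d. f {a, b, c} = f {b, c, d :: nat})"
  have len: "length vs = n" if "vs \<in> L" for vs
    using that length_finite_permutations_of_set unfolding L_def by fastforce
  have "(n - 3) * (card {(a, b, c, d). {a, b, c, d} \<subseteq> {0..<n} \<and> distinct [a, b, c, d] \<and> Q a b c d} * fact (n - 4))
      = (\<Sum>i<n - 3. card {(a, b, c, d). {a, b, c, d} \<subseteq> {0..<n} \<and> distinct [a, b, c, d] \<and> Q a b c d} * fact (n - 4))"
    by simp
  also have "\<dots> \<le> (\<Sum>i<n - 3. card {vs \<in> L. Q (vs ! i) (vs ! (i + 1)) (vs ! (i + 2)) (vs ! (i + 3))})"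
  proof (rule sum_mono)
    fix i assume "i \<in> {..<n - 3}"
    then have i: "i + 3 < n" by simp
    show "card {(a, b, c, d). {a, b, c, d} \<subseteq> {0..<n} \<and> distinct [a, b, c, d] \<and> Q a b c d} * fact (n - 4)
        \<le> card {vs \<in> L. Q (vs ! i) (vs ! (i + 1)) (vs ! (i + 2)) (vs ! (i + 3))}"
      unfolding L_def using card_orderings_first_four card_orderings_window[OF i] by (rule le_trans)
  qed
  also have "\<dots> = (\<Sum>i<n - 3. \<Sum>vs\<in>L. of_bool (Q (vs ! i) (vs ! (i + 1)) (vs ! (i + 2)) (vs ! (i + 3))))"
    by (intro sum.cong refl) (simp add: L_def Int_def)
  also have "\<dots> = (\<Sum>vs\<in>L. \<Sum>i<n - 3. of_bool (Q (vs ! i) (vs ! (i + 1)) (vs ! (i + 2)) (vs ! (i + 3))))"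
    by (rule sum.swap)
  also have "\<dots> = (\<Sum>vs\<in>L. card (coincidences f vs))"
  proof (intro sum.cong refl)
    fix vs assume "vs \<in> L"
    then have "coincidences f vs = {i \<in> {..<n - 3}. Q (vs ! i) (vs ! (i + 1)) (vs ! (i + 2)) (vs ! (i + 3))}"
      using len by (auto simp: coincidences_def Q_def)
    then show "(\<Sum>i<n - 3. of_bool (Q (vs ! i) (vs ! (i + 1)) (vs ! (i + 2)) (vs ! (i + 3)))) = card (coincidences f vs)"
      by (simp add: Int_def)
  qed
  finally show ?thesis by (simp only: L_def Q_def)
qed

text \<open>An interval of length \<open>h\<close> meets at most
  \<open>h div s + 2 \<le> 2 * h / s\<close> blocks of length \<open>s\<close>, so by Cauchy-Schwarz
  at least \<open>h * s / 2\<close> ordered pairs share a block. The \<open>h\<close> diagonal pairs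
  are at most half of this number, because \<open>s \<ge> 4\<close>.\<close>

lemma card_pairs_same_block:
  fixes K s h :: nat
  assumes s: "4 \<le> s" and h: "2 * s \<le> h"
  shows "real h * real s / 4
    \<le> real (card {(a, d). a < h \<and> d < h \<and> a \<noteq> d \<and> (K + a) div s = (K + d) div s})"
proof -
  define g where "g a = (K + a) div s" for a
  define E where "E = {(a, d). a < h \<and> d < h \<and> a \<noteq> d \<and> g a = g d}"
  have fE: "finite E" by (rule finite_subset[of _ "{..<h} \<times> {..<h}"]) (auto simp: E_def)
  have "{(a, d). a \<in> {..<h} \<and> d \<in> {..<h} \<and> g a = g d} = E \<union> (\<lambda>a. (a, a)) ` {..<h}"
    by (auto simp: E_def)
  then have "card {(a, d). a \<in> {..<h} \<and> d \<in> {..<h} \<and> g a = g d} \<le> card E + card ((\<lambda>a. (a, a)) ` {..<h})"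
    by (metis card_Un_le)
  also have "card ((\<lambda>a. (a, a)) ` {..<h}) \<le> h" using card_image_le[of "{..<h}"] by simp
  finally have E: "card {(a, d). a \<in> {..<h} \<and> d \<in> {..<h} \<and> g a = g d} \<le> card E + h" by simp
  \<comment> \<open>The remainders of \<open>K\<close> and \<open>h\<close> modulo \<open>s\<close>
    carry at most once, which accounts for the last block.\<close>
  have "g ` {..<h} \<subseteq> {K div s..K div s + h div s + 1}"
  proof (rule image_subsetI)
    fix a assume "a \<in> {..<h}"
    then have "g a \<le> (K + h) div s" by (simp add: g_def div_le_mono)
    also have "\<dots> = K div s + h div s + (K mod s + h mod s) div s" by (rule div_add1_eq)
    also have "(K mod s + h mod s) div s \<le> 1"
    proof -
      have "K mod s < s" "h mod s < s" using s by auto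
      then have "K mod s + h mod s < 2 * s" by linarith
      then have "(K mod s + h mod s) div s < 2" by (rule less_mult_imp_div_less)
      then show ?thesis by simp
    qed
    finally show "g a \<in> {K div s..K div s + h div s + 1}"
      by (simp add: g_def div_le_mono)
  qed
  then have "card (g ` {..<h}) \<le> h div s + 2"
    using card_mono[of "{K div s..K div s + h div s + 1}" "g ` {..<h}"] by simp
  moreover have "h\<^sup>2 \<le> card (g ` {..<h}) * card {(a, d). a \<in> {..<h} \<and> d \<in> {..<h} \<and> g a = g d}"
    using card_pairs_eq_ge[of "{..<h}" g] by simp
  ultimately have "h\<^sup>2 \<le> (h div s + 2) * (card E + h)"
    using E by (meson le_trans mult_le_mono)
  then have "real (h\<^sup>2) \<le> real ((h div s + 2) * (card E + h))" by (rule of_nat_mono)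
  then have "(real h)\<^sup>2 \<le> (real (h div s) + 2) * (real (card E) + real h)"
    by (simp only: of_nat_mult of_nat_add of_nat_power of_nat_numeral)
  also have "\<dots> \<le> (2 * real h / real s) * (real (card E) + real h)"
  proof (rule mult_right_mono)
    have "real (2 * s) \<le> real h" using h by (rule of_nat_mono)
    then have "2 \<le> real h / real s" using s by (simp add: field_simps)
    moreover have "real (h div s) \<le> real h / real s" by (rule of_nat_div_le_of_nat)
    ultimately show "real (h div s) + 2 \<le> 2 * real h / real s" by simp
  qed simp
  finally have "real h * (real h * real s) \<le> real h * (2 * (real (card E) + real h))"
    using s by (simp add: field_simps power2_eq_square)
  then have "real h * real s \<le> 2 * (real (card E) + real h)"
    using s h by simp
  moreover have "4 * real h \<le> real s * real h" using s by (intro mult_right_mono) auto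
  ultimately have "real h * real s / 4 \<le> real (card E)" by (simp add: mult.commute)
  then show ?thesis by (simp only: E_def g_def)
qed

text \<open>Here the colexicographic order matters: for fixed \<open>b\<close> and \<open>c\<close>
  that are at least \<open>h\<close>, the rank of \<open>{a, b, c}\<close> with \<open>a < h\<close>
  is a constant plus \<open>a\<close>. So the ranks fill an interval of length \<open>h\<close>, and
  the count of pairs in a block applies to each of the \<open>(n - h) * (n - h - 1)\<close> ordered
  pairs \<open>(b, c)\<close>.\<close>

lemma card_quadruples_rank_ge:
  fixes s n h :: nat
  assumes s: "4 \<le> s" and h: "2 * s \<le> h" "h \<le> n"
  shows "real (n - h) * real (n - h - 1) * (real h * real s / 4)
    \<le> real (card {(a, b, c, d). {a, b, c, d} \<subseteq> {0..<n} \<and> distinct [a, b, c, d]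
            \<and> triple_rank {a, b, c} div s = triple_rank {b, c, d} div s})"
    (is "_ \<le> real (card ?Q)")
proof -
  define P where "P = {(b, c). b \<in> {h..<n} \<and> c \<in> {h..<n} \<and> b \<noteq> c}"
  \<comment> \<open>The part of the rank that depends on the two larger vertices, which may come in
    either order.\<close>
  define \<kappa> where "\<kappa> b c = (min b c choose 2) + (max b c choose 3)" for b c :: nat
  define R where "R = (\<lambda>(b, c). {(a, d). a < h \<and> d < h \<and> a \<noteq> d \<and> (\<kappa> b c + a) div s = (\<kappa> b c + d) div s})"
  have rank: "triple_rank {a, b, c} = \<kappa> b c + a" if "a < h" "(b, c) \<in> P" for a b c
  proof (cases "b < c")
    case True
    then show ?thesis using that by (simp add: triple_rank_sorted P_def \<kappa>_def)
  next
    case False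
    then have "triple_rank {a, c, b} = \<kappa> b c + a"
      using that by (subst triple_rank_sorted) (auto simp: P_def \<kappa>_def)
    then show ?thesis by (simp add: insert_commute)
  qed
  have fP: "finite P" by (rule finite_subset[of _ "{h..<n} \<times> {h..<n}"]) (auto simp: P_def)
  have fR: "finite (R z)" for z
    by (rule finite_subset[of _ "{..<h} \<times> {..<h}"]) (auto simp: R_def split: prod.splits)
  have "P = Sigma {h..<n} (\<lambda>b. {h..<n} - {b})" by (auto simp: P_def)
  also have "card \<dots> = (\<Sum>b\<in>{h..<n}. card ({h..<n} - {b}))"
    by (rule card_SigmaI) auto
  also have "\<dots> = (n - h) * (n - h - 1)" by simp
  finally have cP: "real (card P) = real (n - h) * real (n - h - 1)" by (metis of_nat_mult)
  have "real (card P) * (real h * real s / 4) = (\<Sum>z\<in>P. real h * real s / 4)" by simp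
  also have "\<dots> \<le> (\<Sum>z\<in>P. real (card (R z)))"
  proof (rule sum_mono)
    fix z :: "nat \<times> nat"
    obtain b c where "z = (b, c)" by (cases z)
    then show "real h * real s / 4 \<le> real (card (R z))"
      using card_pairs_same_block[OF s h(1), of "\<kappa> b c"] by (simp add: R_def)
  qed
  also have "\<dots> = real (card (Sigma P R))" using fP fR by simp
  also have "card (Sigma P R) \<le> card ?Q"
  proof (rule card_inj_on_le[where f = "\<lambda>((b, c), (a, d)). (a, b, c, d)"])
    show "inj_on (\<lambda>((b, c), (a, d)). (a, b, c, d)) (Sigma P R)" by (auto simp: inj_on_def)
    show "(\<lambda>((b, c), (a, d)). (a, b, c, d)) ` Sigma P R \<subseteq> ?Q"
    proof (rule image_subsetI)
      fix x assume "x \<in> Sigma P R"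
      then obtain a b c d where x: "x = ((b, c), (a, d))" and bc: "(b, c) \<in> P"
        and ad: "a < h" "d < h" "a \<noteq> d" "(\<kappa> b c + a) div s = (\<kappa> b c + d) div s"
        by (auto simp: R_def)
      have "triple_rank {b, c, d} = \<kappa> b c + d" using rank[OF ad(2) bc] by (simp add: insert_commute)
      then show "(\<lambda>((b, c), (a, d)). (a, b, c, d)) x \<in> ?Q"
        using rank[OF ad(1) bc] bc ad h by (simp add: x P_def)
    qed
    show "finite ?Q"
      by (rule finite_subset[of _ "{0..<n} \<times> {0..<n} \<times> {0..<n} \<times> {0..<n}"]) auto
  qed
  finally show ?thesis by (simp add: cP)
qed

text \<open>With \<open>h\<close> half of \<open>n\<close>, the factors \<open>n - h\<close>,
  \<open>n - h - 1\<close> and \<open>h\<close> are at least half of \<open>n\<close>,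
  \<open>n - 2\<close> and \<open>n - 1\<close>. The resulting 1 / 8 and the 1 / 4 from the pairs in
  a block make 1 / 32; the windows and the remaining vertices supply the rest of
  \<open>fact n\<close>.\<close>

lemma sum_coincidences_rank_ge:
  fixes s n :: nat
  assumes s: "4 \<le> s" and h: "2 * s \<le> n div 2"
  shows "real s / 32 * fact n
    \<le> (\<Sum>vs\<in>permutations_of_set {0..<n}. real (card (coincidences (\<lambda>e. triple_rank e div s) vs)))"
proof -
  define h where "h = n div 2"
  define q where "q = card {(a, b, c, d). {a, b, c, d} \<subseteq> {0..<n} \<and> distinct [a, b, c, d]
            \<and> triple_rank {a, b, c} div s = triple_rank {b, c, d} div s}"
  have n: "16 \<le> n" using assms by simp
  have q: "real (n - h) * real (n - h - 1) * (real h * real s / 4) \<le> real q"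
    unfolding q_def using assms by (intro card_quadruples_rank_ge) (auto simp: h_def)
  have "2 * (n - h) \<ge> n" "2 * (n - h - 1) \<ge> n - 2" "2 * h \<ge> n - 1" using n by (auto simp: h_def)
  then have "real n \<le> 2 * real (n - h)" "real (n - 2) \<le> 2 * real (n - h - 1)" "real (n - 1) \<le> 2 * real h"
    by linarith+
  then have "real n * real (n - 2) * real (n - 1) \<le> (2 * real (n - h)) * (2 * real (n - h - 1)) * (2 * real h)"
    by (intro mult_mono) auto
  then have "real n * real (n - 2) * real (n - 1) * (real s / 32)
      \<le> (2 * real (n - h)) * (2 * real (n - h - 1)) * (2 * real h) * (real s / 32)"
    by (rule mult_right_mono) simp
  also have "\<dots> = real (n - h) * real (n - h - 1) * (real h * real s / 4)" by simp
  also note q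
  finally have *: "real n * real (n - 2) * real (n - 1) * (real s / 32) \<le> real q" .
  have "fact n = real n * (real (n - 1) * (real (n - 2) * (real (n - 3) * fact (n - 4))))"
  proof -
    have "n = Suc (Suc (Suc (Suc (n - 4))))" using n by simp
    then obtain m where "n = Suc (Suc (Suc (Suc m)))" by blast
    then show ?thesis by (simp del: of_nat_Suc)
  qed
  then have "real s / 32 * fact n = (real n * real (n - 2) * real (n - 1) * (real s / 32)) * (real (n - 3) * fact (n - 4))"
    by (simp add: mult_ac)
  also have "\<dots> \<le> real q * (real (n - 3) * fact (n - 4))"
    using * by (rule mult_right_mono) simp
  also have "\<dots> = real ((n - 3) * (q * fact (n - 4)))" by (simp add: mult_ac)
  also have "\<dots> \<le> real (\<Sum>vs\<in>permutations_of_set {0..<n}. card (coincidences (\<lambda>e. triple_rank e div s) vs))"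
    unfolding q_def using n by (intro of_nat_mono sum_coincidences_ge) simp
  finally show ?thesis by simp
qed

section \<open>Cluster sizes and asymptotic estimates\<close>

lemma real_choose_3: "real (m choose 3) = real m * (real m - 1) * (real m - 2) / 6"
  unfolding binomial_gbinomial
  by (simp add: gbinomial_prod_rev numeral_3_eq_3 lessThan_Suc fact_numeral atLeast0_lessThan_Suc algebra_simps)

text \<open>As q^4 - 1 = (q - 1)(q + 1)(q^2 + 1), dividing (q^4 + 1) q^4 (q^4 - 1) by (q + 1) q (q -
  1) leaves q^3 (q^2 + 1)(q^4 + 1). Thus the number whose product with \<open>p\<close> is assumed
  to be an integer serves as the number of clusters.\<close>

lemma choose_3_factor:
  fixes q :: nat
  shows "(q ^ 4 + 1) choose 3 = q ^ 3 * (q ^ 6 + q ^ 4 + q ^ 2 + 1) * (Suc q choose 3)"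
proof -
  have "real ((q ^ 4 + 1) choose 3) = real (q ^ 3 * (q ^ 6 + q ^ 4 + q ^ 2 + 1) * (Suc q choose 3))"
    unfolding of_nat_mult real_choose_3 by (simp add: field_simps) algebra
  then show ?thesis by (simp only: of_nat_eq_iff)
qed

text \<open>The conditions of the counting argument for \<open>n = q ^ 4 + 1\<close>, in turn:
  enough chosen clusters for the correction 1 / 2; a failure exponent of order q^9, which beats
  terms of order q^4; an exponent \<open>s / 32\<close> that absorbs the polynomial losses and still
  leaves \<open>2 * q\<close>; clusters of size at most a quarter of \<open>n\<close>; and
  \<open>q\<close> large enough for \<open>s \<ge> 4\<close>.\<close>

lemma H3_asymptotics:
  fixes p \<kappa> :: real
  assumes p: "0 < p" "p < 1" and \<kappa>: "0 < \<kappa>"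
  shows "\<forall>\<^sub>F q :: nat in sequentially.
      2 * (real q ^ 4 + 1)\<^sup>2 \<le> p * (real q ^ 3 * (real q ^ 6 + real q ^ 4 + real q ^ 2 + 1)) \<and>
      (real q ^ 4 + 1) * (ln 2 - ln p) + ln (8 * (real q ^ 3 * (real q ^ 6 + real q ^ 4 + real q ^ 2 + 1) + 1))
        \<le> \<kappa> * ((real q ^ 4 / 2 - 2) ^ 3 / 6) / (real q ^ 3 / 6) \<and>
      ln (2 * (real q ^ 4 + 1)\<^sup>2) \<le> ln (1 / p) * ((real q + 1) * real q * (real q - 1) / 192 - 2 * real q) \<and>
      (real q + 1) * real q * (real q - 1) / 3 \<le> real q ^ 4 / 2 - 1 \<and>
      4 \<le> q"
proof -
  define l where "l = ln (1 / p)"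
  have l: "l > 0" using p by (simp add: l_def)
  have l': "ln p = - l" using p by (simp add: l_def ln_div)
  have "\<forall>\<^sub>F q :: nat in sequentially. 2 * (real q ^ 4 + 1)\<^sup>2 \<le> p * (real q ^ 3 * (real q ^ 6 + real q ^ 4 + real q ^ 2 + 1))"
    using p by real_asymp
  moreover have "\<forall>\<^sub>F q :: nat in sequentially. 
      (real q ^ 4 + 1) * (ln 2 - ln p) + ln (8 * (real q ^ 3 * (real q ^ 6 + real q ^ 4 + real q ^ 2 + 1) + 1))
        \<le> \<kappa> * ((real q ^ 4 / 2 - 2) ^ 3 / 6) / (real q ^ 3 / 6)"
    unfolding l' using \<kappa> l by real_asymp
  moreover have "\<forall>\<^sub>F q :: nat in sequentially. 
      ln (2 * (real q ^ 4 + 1)\<^sup>2) \<le> l * ((real q + 1) * real q * (real q - 1) / 192 - 2 * real q)"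
    using l by real_asymp
  moreover have "\<forall>\<^sub>F q :: nat in sequentially. (real q + 1) * real q * (real q - 1) / 3 \<le> real q ^ 4 / 2 - 1"
    by real_asymp
  moreover have "\<forall>\<^sub>F q :: nat in sequentially. 4 \<le> q" by (rule eventually_ge_at_top)
  ultimately show ?thesis unfolding l_def by eventually_elim blast
qed

section \<open>The lower bound\<close>

theorem theorem4:
  fixes \<epsilon> p :: real
  assumes "\<epsilon> > 0" and "0 < p" and "p < 1" and "\<exists>m::nat. 1 / p = real m"
  shows "\<exists>c > 0. \<exists>Q::nat. \<forall>q::nat.
           q \<ge> Q \<and> primepow q \<and>
           p * real q ^ 3 * real (q ^ 6 + q ^ 4 + q ^ 2 + 1) \<in> \<int> \<longrightarrow>
           (1 / p) powr (c * real (q ^ 4 + 1) powr (1 / 4))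
             \<le> real (H3 (q ^ 4 + 1) p \<epsilon>) / Eexp (q ^ 4 + 1) p"
proof -
  note p = assms(2,3)
  define \<delta> where "\<delta> = min 1 \<epsilon> / 2"
  define \<kappa> where "\<kappa> = \<delta> * \<epsilon> / 2"
  have \<kappa>: "\<kappa> > 0" using assms(1) by (simp add: \<kappa>_def \<delta>_def)
  obtain Q where Q: "\<And>q :: nat. q \<ge> Q \<Longrightarrow>
      2 * (real q ^ 4 + 1)\<^sup>2 \<le> p * (real q ^ 3 * (real q ^ 6 + real q ^ 4 + real q ^ 2 + 1)) \<and>
      (real q ^ 4 + 1) * (ln 2 - ln p) + ln (8 * (real q ^ 3 * (real q ^ 6 + real q ^ 4 + real q ^ 2 + 1) + 1))
        \<le> \<kappa> * ((real q ^ 4 / 2 - 2) ^ 3 / 6) / (real q ^ 3 / 6) \<and>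
      ln (2 * (real q ^ 4 + 1)\<^sup>2) \<le> ln (1 / p) * ((real q + 1) * real q * (real q - 1) / 192 - 2 * real q) \<and>
      (real q + 1) * real q * (real q - 1) / 3 \<le> real q ^ 4 / 2 - 1 \<and>
      4 \<le> q"
    using H3_asymptotics[OF p \<kappa>] unfolding eventually_sequentially by blast
  \<comment> \<open>The constant 1 leaves room: the gained exponent is of order
    \<open>q ^ 3\<close>, of which only \<open>2 * q\<close> is kept, and the fourth root of
    \<open>n\<close> is at most \<open>2 * q\<close>.\<close>
  have "(1 / p) powr (1 * real (q ^ 4 + 1) powr (1 / 4)) \<le> real (H3 (q ^ 4 + 1) p \<epsilon>) / Eexp (q ^ 4 + 1) p"
    if q: "q \<ge> Q" and int: "p * real q ^ 3 * real (q ^ 6 + q ^ 4 + q ^ 2 + 1) \<in> \<int>" for q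
  proof -
    define n where "n = q ^ 4 + 1"
    define N where "N = q ^ 3 * (q ^ 6 + q ^ 4 + q ^ 2 + 1)"
    define s where "s = Suc q choose 3"
    have n_real: "real n = real q ^ 4 + 1" by (simp add: n_def)
    have N_real: "real N = real q ^ 3 * (real q ^ 6 + real q ^ 4 + real q ^ 2 + 1)"
      by (simp add: N_def algebra_simps)
    have s_real: "real s = (real q + 1) * real q * (real q - 1) / 6"
      unfolding s_def real_choose_3 by simp
    have s_multiples: "(real q + 1) * real q * (real q - 1) / 192 = real s / 32"
      "(real q + 1) * real q * (real q - 1) / 3 = 2 * real s"
      unfolding s_real by simp_all
    have Q1: "2 * (real n)\<^sup>2 \<le> p * real N"
      and Q2: "real n * (ln 2 - ln p) + ln (8 * (real N + 1))
        \<le> \<kappa> * ((real q ^ 4 / 2 - 2) ^ 3 / 6) / (real q ^ 3 / 6)"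
      and Q3: "ln (2 * (real n)\<^sup>2) \<le> ln (1 / p) * (real s / 32 - 2 * real q)"
      and Q4: "2 * real s \<le> real q ^ 4 / 2 - 1"
      and q4: "4 \<le> q"
      using Q[OF q, folded n_real N_real, unfolded s_multiples] by blast+
    have "q ^ 4 \<ge> 4 ^ 4" using q4 by (rule power_mono) simp
    then have n_ge: "257 \<le> n" by (simp add: n_def)
    define h where "h = n div 2"
    have "q ^ 4 \<le> 2 * h" by (simp add: h_def n_def)
    then have h_ge: "real q ^ 4 / 2 \<le> real h"
      using of_nat_mono[of "q ^ 4" "2 * h", where 'a = real] by simp
    have s_ge: "4 \<le> s"
    proof -
      have "(5 * 4 * 3 :: real) \<le> (real q + 1) * real q * (real q - 1)"
        using q4 by (intro mult_mono) auto
      then have "10 \<le> real s" unfolding s_real by simp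
      then show ?thesis by simp
    qed
    have s_le: "real s \<le> real q ^ 3 / 6"
      unfolding s_real by (simp add: power3_eq_cube algebra_simps)
    have sh: "2 * s \<le> h" using Q4 h_ge by linarith
    interpret triple_clustering n N s "\<lambda>e. triple_rank e div s"
    proof (rule triple_clustering_rank)
      show "n choose 3 = N * s" unfolding n_def N_def s_def by (rule choose_3_factor)
    qed (use s_ge in simp)
    \<comment> \<open>The integrality hypothesis supplies the number \<open>M\<close> of chosen
      clusters that gives density exactly \<open>p\<close>.\<close>
    have int': "p * real N \<in> \<int>" 
    proof -
      have "p * real N = p * real q ^ 3 * real (q ^ 6 + q ^ 4 + q ^ 2 + 1)"
        unfolding N_def of_nat_mult by simp
      then show ?thesis using int by metis
    qed
    then obtain z where z: "p * real N = of_int z" by (auto elim: Ints_cases)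
    moreover have "0 \<le> p * real N" using p by simp
    ultimately have "real (nat z) = p * real N" by simp
    then obtain M where M: "real M = p * real N" by blast
    have choose_ge: "(real q ^ 4 / 2 - 2) ^ 3 / 6 \<le> real (h choose 3)"
    proof -
      have "4 ^ 4 \<le> real q ^ 4" using q4 by (intro power_mono) auto
      then have "0 \<le> real q ^ 4 / 2 - 2" by simp
      then have "(real q ^ 4 / 2 - 2) ^ 3 \<le> real h * (real h - 1) * (real h - 2)"
        unfolding power3_eq_cube using h_ge by (intro mult_mono mult_nonneg_nonneg) auto
      then show ?thesis by (simp add: real_choose_3)
    qed
    have bad: "2 ^ n * (2 * real (N + 1) * exp (- (\<delta> * \<epsilon> / 2 * real (n div 2 choose 3) / real s))) \<le> p ^ n / 4"
    proof -
      define X where "X = \<kappa> * real (h choose 3) / real s"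
      have "\<kappa> * ((real q ^ 4 / 2 - 2) ^ 3 / 6) / (real q ^ 3 / 6) \<le> X"
        unfolding X_def using choose_ge s_le s_ge \<kappa> by (intro frac_le mult_left_mono) auto
      then have "real n * (ln 2 - ln p) + ln (8 * (real N + 1)) \<le> X" using Q2 by linarith
      then have "exp (real n * (ln 2 - ln p) + ln (8 * (real N + 1))) \<le> exp X" by simp
      moreover have "exp (real n * (ln 2 - ln p)) = (2 / p) ^ n"
        using p by (simp add: exp_of_nat_mult exp_diff)
      ultimately have "(2 / p) ^ n * (8 * (real N + 1)) \<le> exp X" by (simp add: exp_add)
      then have le: "p ^ n / 4 * ((2 / p) ^ n * (8 * (real N + 1)) * exp (- X)) \<le> p ^ n / 4 * (exp X * exp (- X))"
        using p by (intro mult_left_mono mult_right_mono) auto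
      \<comment> \<open>The number of sets \<open>W\<close> and the target \<open>p ^ n\<close>
        combine into \<open>(2 / p) ^ n\<close>; this is the origin of \<open>ln 2 - ln p\<close> in
        the asymptotic condition.\<close>
      have pow: "2 ^ n = p ^ n * (2 / p) ^ n" using p by (simp flip: power_mult_distrib)
      have "2 ^ n * (2 * real (N + 1) * exp (- X)) = p ^ n / 4 * ((2 / p) ^ n * (8 * (real N + 1)) * exp (- X))"
        unfolding pow by (simp add: algebra_simps)
      also note le
      also have "p ^ n / 4 * (exp X * exp (- X)) = p ^ n / 4" by (simp flip: exp_add)
      finally have "2 ^ n * (2 * real (N + 1) * exp (- X)) \<le> p ^ n / 4" .
      then show ?thesis by (simp add: X_def \<kappa>_def h_def)
    qed
    have main: "p ^ n * (1 / p) powr (real s / 32) * fact n / 4 \<le> real n ^ 3 * real (H3 n p \<epsilon>)"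
    proof (rule H3_ge[OF p M assms(1) _ _ \<delta>_def bad])
      show "real s / 32 * fact n \<le> (\<Sum>vs\<in>permutations_of_set {0..<n}.
          real (card (coincidences (\<lambda>e. triple_rank e div s) vs)))"
        using s_ge sh by (intro sum_coincidences_rank_ge) (auto simp: h_def)
    qed (use n_ge Q1 M in auto)
    have n_pos: "0 < real n" using n_ge by simp
    \<comment> \<open>The factor \<open>2 * n\<^sup>2\<close> is the total loss:
      \<open>4 * n ^ 3\<close> from the bad choices and the counting of orderings, set against
      \<open>fact n = n * fact (n - 1)\<close> and the 1 / 2 in \<open>Eexp\<close>.\<close>
    have "2 * (real n)\<^sup>2 * (1 / p) powr (2 * real q) \<le> (1 / p) powr (real s / 32)"
    proof -
      have "2 * (real n)\<^sup>2 = exp (ln (2 * (real n)\<^sup>2))" using n_pos by simp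
      also have "\<dots> \<le> exp (ln (1 / p) * (real s / 32 - 2 * real q))" using Q3 by simp
      also have "\<dots> = (1 / p) powr (real s / 32 - 2 * real q)"
        using p by (simp add: powr_def mult.commute)
      finally have "2 * (real n)\<^sup>2 * (1 / p) powr (2 * real q)
          \<le> (1 / p) powr (real s / 32 - 2 * real q) * (1 / p) powr (2 * real q)"
        by (rule mult_right_mono) simp
      then show ?thesis by (simp flip: powr_add)
    qed
    then have "p ^ n * (2 * (real n)\<^sup>2 * (1 / p) powr (2 * real q)) * fact n / 4
        \<le> p ^ n * (1 / p) powr (real s / 32) * fact n / 4"
      using p by (intro divide_right_mono mult_right_mono mult_left_mono) auto
    also note main
    finally have *: "p ^ n * (2 * (real n)\<^sup>2 * (1 / p) powr (2 * real q)) * fact n / 4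
        \<le> real n ^ 3 * real (H3 n p \<epsilon>)" .
    have "(fact n :: real) = real n * fact (n - 1)" using n_ge by (cases n) simp_all
    then have eq: "p ^ n * (2 * (real n)\<^sup>2 * (1 / p) powr (2 * real q)) * fact n / 4
        = real n ^ 3 * ((1 / p) powr (2 * real q) * Eexp n p)"
      by (simp add: Eexp_def power2_eq_square power3_eq_cube)
    have "real n ^ 3 * ((1 / p) powr (2 * real q) * Eexp n p) \<le> real n ^ 3 * real (H3 n p \<epsilon>)"
      using * unfolding eq .
    then have H3: "(1 / p) powr (2 * real q) * Eexp n p \<le> real (H3 n p \<epsilon>)"
      using n_pos by simp
    have "Eexp n p > 0" using p by (simp add: Eexp_def)
    with H3 have "(1 / p) powr (2 * real q) \<le> real (H3 n p \<epsilon>) / Eexp n p"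
      by (simp add: field_simps)
    moreover have "(1 / p) powr (1 * real n powr (1 / 4)) \<le> (1 / p) powr (2 * real q)"
    proof (rule powr_mono)
      have "real q ^ 4 \<ge> 1" using q4 by (intro one_le_power) simp
      then have "real n \<le> (2 * real q) ^ 4" by (simp add: n_real power_mult_distrib)
      then have "real n powr (1 / 4) \<le> ((2 * real q) ^ 4) powr (1 / 4)"
        using n_pos by (intro powr_mono2) auto
      also have "\<dots> = 2 * real q"
      proof -
        have "(2 * real q) ^ 4 = (2 * real q) powr 4" using q4 by simp
        then show ?thesis using q4 by (simp only: powr_powr) simp
      qed
      finally show "1 * real n powr (1 / 4) \<le> 2 * real q" by simp
    qed (use p in auto)
    ultimately show ?thesis by (simp only: n_def)
  qed
  then show ?thesis by (intro exI[of _ 1] conjI exI[of _ Q]) auto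
qed

end
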